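(* For every integer $n\geq 5$, there are origin-symmetric convex bodies of revolution $K,L\subset\mathbb{R}^n$ such that \[ |K\cap\xi^\perp|_{n-1}<|L\cap\xi^\perp|_{n-1} \quad\text{and}\quad |K\mid\xi^\perp|_{n-1}<|L\mid\xi^\perp|_{n-1} \qquad\text{for all }\xi\in\mathbb{S}^{n-1}, \] but $|K|_n>|L|_n$.
   Context: A convex body in $\mathbb{R}^n$ is a compact convex set with nonempty interior; it is origin-symmetric if $K=-K$. $\mathbb{S}^{n-1}$ is the Euclidean unit sphere, $\xi^\perp$ is the hyperplane through the origin orthogonal to $\xi$, $K\mid\xi^\perp$ is the orthogonal projection of $K$ onto $\xi^\perp$, and $|A|_k$ denotes $k$-dimensional volume. A body of revolution is a body invariant under every orthogonal transformation that fixes a distinguished axis (a line through the origin) pointwise. *)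

theory Defs
  imports "HOL-Analysis.Analysis"
begin

definition convex_body :: "'a::euclidean_space set \<Rightarrow> bool" where
  "convex_body K \<longleftrightarrow> compact K \<and> convex K \<and> interior K \<noteq> {}"

definition origin_symmetric :: "'a::euclidean_space set \<Rightarrow> bool" where
  "origin_symmetric K \<longleftrightarrow> K = uminus ` K"

text \<open>The axis is the line spanned by \<open>u\<close>; each body may have its own axis.\<close>

definition body_of_revolution :: "'a::euclidean_space set \<Rightarrow> bool" where
  "body_of_revolution K \<longleftrightarrow>
     (\<exists>u. u \<noteq> 0 \<and>
       (\<forall>T. orthogonal_transformation T \<and> (\<forall>x\<in>span {u}. T x = x) \<longrightarrow> T ` K = K))"

definition orthogonal_projection :: "'a::euclidean_space set \<Rightarrow> 'a set \<Rightarrow> 'a set" where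
  "orthogonal_projection S A = {y \<in> S. \<exists>x\<in>A. x - y \<in> S\<^sup>\<bottom>}"

lemma orthogonal_projection_hyperplane:
  assumes "norm \<xi> = 1"
  shows "orthogonal_projection ({\<xi>}\<^sup>\<bottom>) A = (\<lambda>x. x - (x \<bullet> \<xi>) *\<^sub>R \<xi>) ` A"
proof -
  have one: "\<xi> \<bullet> \<xi> = 1"
    using assms by (simp add: norm_eq_1)
  have *: "z = (z \<bullet> \<xi>) *\<^sub>R \<xi>" if "z \<in> {\<xi>}\<^sup>\<bottom>\<^sup>\<bottom>" for z
  proof -
    let ?w = "z - (z \<bullet> \<xi>) *\<^sub>R \<xi>"
    have w: "\<xi> \<bullet> ?w = 0"
      using one by (simp add: inner_diff_right inner_commute)
    then have "?w \<bullet> z = 0"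
      using that by (auto simp: orthogonal_comp_def orthogonal_def)
    with w have "?w \<bullet> ?w = 0"
      by (metis inner_commute inner_diff_right inner_scaleR_right diff_zero mult_zero_right)
    then show ?thesis by simp
  qed
  have "y = x - (x \<bullet> \<xi>) *\<^sub>R \<xi>" if "y \<in> {\<xi>}\<^sup>\<bottom>" "x - y \<in> {\<xi>}\<^sup>\<bottom>\<^sup>\<bottom>" for x y
    using *[OF that(2)] that(1)
    by (simp add: orthogonal_comp_def orthogonal_def inner_diff_left inner_commute algebra_simps)
  moreover have "x - (x \<bullet> \<xi>) *\<^sub>R \<xi> \<in> {\<xi>}\<^sup>\<bottom>" for x
    using one by (simp add: orthogonal_comp_def orthogonal_def inner_diff_right inner_commute)
  moreover have "x - (x - (x \<bullet> \<xi>) *\<^sub>R \<xi>) \<in> {\<xi>}\<^sup>\<bottom>\<^sup>\<bottom>" for x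
    by (simp add: orthogonal_comp_def orthogonal_def inner_commute)
  ultimately show ?thesis
    unfolding orthogonal_projection_def by blast
qed

definition orthonormal_basis_of :: "'a::euclidean_space set \<Rightarrow> 'a set \<Rightarrow> bool" where
  "orthonormal_basis_of S B \<longleftrightarrow> pairwise orthogonal B \<and> (\<forall>b\<in>B. norm b = 1) \<and> span B = S"

text \<open>Lebesgue measure of the subspace spanned by an orthonormal set \<open>B\<close>, as a Borel measure
  on the ambient space; for \<open>B = Basis\<close> this is \<open>lborel\<close>, see \<open>lborel_eq\<close>.\<close>

definition coord_lborel :: "'a::euclidean_space set \<Rightarrow> 'a measure" where
  "coord_lborel B = distr (\<Pi>\<^sub>M b\<in>B. lborel) borel (\<lambda>f. \<Sum>b\<in>B. f b *\<^sub>R b)"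

text \<open>The \<open>dim S\<close>-dimensional volume of a Borel set \<open>A \<subseteq> S\<close>, for a linear subspace \<open>S\<close>.\<close>

definition subspace_volume :: "'a::euclidean_space set \<Rightarrow> 'a set \<Rightarrow> real" where
  "subspace_volume S A = measure (coord_lborel (SOME B. orthonormal_basis_of S B)) A"

text \<open>The choice of basis is immaterial (\<open>subspace_volume_eq\<close>), by uniqueness of the
  translation- and reflection-invariant measure on \<open>S\<close>, normalised by a Gaussian integral.\<close>

lemma orthonormal_basis_of_finite:
  assumes "orthonormal_basis_of S B"
  shows "finite B"
  using assms pairwise_orthogonal_imp_finite unfolding orthonormal_basis_of_def by blast

lemma orthonormal_basis_of_exists:
  assumes "subspace S"
  shows "\<exists>B. orthonormal_basis_of S B"
  using orthonormal_basis_subspace[OF assms] unfolding orthonormal_basis_of_def by metis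

lemma orthonormal_basis_of_inner:
  assumes "orthonormal_basis_of S B" "b \<in> B" "c \<in> B"
  shows "b \<bullet> c = (if b = c then 1 else 0)"
  using assms
  by (auto simp: orthonormal_basis_of_def pairwise_def orthogonal_def norm_eq_1)

lemma orthonormal_basis_of_expand:
  fixes S :: "'a::euclidean_space set"
  assumes B: "orthonormal_basis_of S B" and v: "v \<in> S"
  shows "(\<Sum>b\<in>B. (v \<bullet> b) *\<^sub>R b) = v"
proof -
  have fin: "finite B" using B by (rule orthonormal_basis_of_finite)
  obtain a where a: "v = (\<Sum>b\<in>B. a b *\<^sub>R b)"
    using v B span_finite[OF fin] unfolding orthonormal_basis_of_def by auto
  have "v \<bullet> c = a c" if "c \<in> B" for c
    using that fin unfolding a
    by (simp add: inner_sum_left orthonormal_basis_of_inner[OF B] if_distrib cong: if_cong sum.cong)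
  then show ?thesis using a by simp
qed

lemma coord_lborel_reflect:
  fixes S :: "'a::euclidean_space set"
  assumes B: "orthonormal_basis_of S B" and v: "v \<in> S"
    and h[measurable]: "h \<in> borel_measurable borel"
  shows "(\<integral>\<^sup>+f. h (v - (\<Sum>b\<in>B. f b *\<^sub>R b)) \<partial>(\<Pi>\<^sub>M b\<in>B. lborel))
       = (\<integral>\<^sup>+f. h (\<Sum>b\<in>B. f b *\<^sub>R b) \<partial>(\<Pi>\<^sub>M b\<in>B. lborel))"
proof -
  have fin: "finite B" using B by (rule orthonormal_basis_of_finite)
  let ?P = "\<Pi>\<^sub>M b\<in>B. (lborel :: real measure)"
  let ?T = "\<lambda>f. \<lambda>b\<in>B. (v \<bullet> b) - f b"
  interpret product_sigma_finite "\<lambda>b::'a. lborel :: real measure" ..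
  have T[measurable]: "?T \<in> measurable ?P ?P" by measurable
  have one: "emeasure lborel ((\<lambda>t. c - t) -` A) = emeasure lborel A" if "A \<in> sets borel" for A and c :: real
  proof -
    have "distr lborel borel (\<lambda>t. c + (-1) * t) = (lborel :: real measure)"
      using lborel_real_affine[of "-1" c] by (simp add: density_1)
    then have "emeasure lborel A = emeasure (distr lborel borel (\<lambda>t. c - t)) A" by simp
    then show ?thesis using that by (simp add: emeasure_distr)
  qed
  have "distr ?P ?P ?T = ?P"
  proof (rule PiM_eqI[OF fin])
    fix A :: "'a \<Rightarrow> real set" assume A: "\<And>i. i \<in> B \<Longrightarrow> A i \<in> sets lborel"
    have "?T -` (Pi\<^sub>E B A) \<inter> space ?P = (\<Pi>\<^sub>E b\<in>B. (\<lambda>t. v \<bullet> b - t) -` A b)"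
      by (auto simp: space_PiM PiE_iff)
    moreover have "(\<lambda>t. v \<bullet> b - t) -` A b \<in> sets borel" if "b \<in> B" for b
      using measurable_sets[of "\<lambda>t. v \<bullet> b - t" borel borel "A b"] A[OF that] by simp
    moreover have "Pi\<^sub>E B A \<in> sets ?P" using A fin by (intro sets_PiM_I_finite) auto
    ultimately show "emeasure (distr ?P ?P ?T) (Pi\<^sub>E B A) = (\<Prod>i\<in>B. emeasure lborel (A i))"
      using A fin by (simp add: emeasure_distr emeasure_PiM one)
  qed simp
  then have "(\<integral>\<^sup>+f. h (\<Sum>b\<in>B. f b *\<^sub>R b) \<partial>?P) = (\<integral>\<^sup>+f. h (\<Sum>b\<in>B. f b *\<^sub>R b) \<partial>(distr ?P ?P ?T))"
    by simp
  also have "\<dots> = (\<integral>\<^sup>+f. h (\<Sum>b\<in>B. ?T f b *\<^sub>R b) \<partial>?P)"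
    by (rule nn_integral_distr) measurable
  also have "(\<lambda>f. \<Sum>b\<in>B. ?T f b *\<^sub>R b) = (\<lambda>f. v - (\<Sum>b\<in>B. f b *\<^sub>R b))"
    using orthonormal_basis_of_expand[OF B v]
    by (simp add: scaleR_diff_left sum_subtractf cong: sum.cong)
  then have "(\<integral>\<^sup>+f. h (\<Sum>b\<in>B. ?T f b *\<^sub>R b) \<partial>?P) = (\<integral>\<^sup>+f. h (v - (\<Sum>b\<in>B. f b *\<^sub>R b)) \<partial>?P)"
    by metis
  finally show ?thesis by simp
qed

lemma gauss_finite: "(\<integral>\<^sup>+t. ennreal (exp (- (t\<^sup>2))) \<partial>(lborel :: real measure)) \<noteq> \<infinity>"
proof -
  let ?p = "\<lambda>t::real. 1 / (1 + t\<^sup>2)"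
  have le: "exp (- (t\<^sup>2)) \<le> ?p t" for t :: real
    using exp_ge_add_one_self[of "t\<^sup>2"]
    by (simp add: exp_minus field_simps add_pos_nonneg)
  have half: "(\<integral>\<^sup>+t. ennreal (?p t) * indicator {0..} t \<partial>lborel) = ennreal (pi/2 - arctan 0)"
    by (rule nn_integral_FTC_atLeast)
       (auto intro!: derivative_eq_intros tendsto_arctan_at_top simp: inverse_eq_divide)
  have "(\<integral>\<^sup>+t. ennreal (?p t) * indicator {..0} t \<partial>lborel)
      = (\<integral>\<^sup>+t. ennreal (?p t) * indicator {0..} t \<partial>lborel)"
    by (subst nn_integral_real_affine[where c="-1" and t=0])
       (auto simp: indicator_def intro!: nn_integral_cong)
  note half' = this[unfolded half]
  have "(\<integral>\<^sup>+t. ennreal (exp (- (t\<^sup>2))) \<partial>(lborel :: real measure))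
      \<le> (\<integral>\<^sup>+t. ennreal (?p t) * indicator {0..} t + ennreal (?p t) * indicator {..0} t \<partial>lborel)"
    by (intro nn_integral_mono)
       (auto simp: indicator_def le intro!: ennreal_leI order_trans[OF le] add_increasing)
  also have "\<dots> = ennreal (pi/2 - arctan 0) + ennreal (pi/2 - arctan 0)"
    by (subst nn_integral_add) (simp_all only: half half', auto)
  also have "\<dots> < \<infinity>" by simp
  finally show ?thesis by simp
qed

lemma gauss_pos: "(\<integral>\<^sup>+t. ennreal (exp (- (t\<^sup>2))) \<partial>(lborel :: real measure)) \<noteq> 0"
  by (subst nn_integral_0_iff) auto

lemma coord_lborel_gauss:
  fixes S :: "'a::euclidean_space set"
  assumes B: "orthonormal_basis_of S B"
  shows "(\<integral>\<^sup>+f. ennreal (exp (- ((norm (\<Sum>b\<in>B. f b *\<^sub>R b))\<^sup>2))) \<partial>(\<Pi>\<^sub>M b\<in>B. lborel))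
       = (\<integral>\<^sup>+t. ennreal (exp (- (t\<^sup>2))) \<partial>(lborel :: real measure)) ^ dim S"
proof -
  have fin: "finite B" using B by (rule orthonormal_basis_of_finite)
  interpret product_sigma_finite "\<lambda>b::'a. lborel :: real measure" ..
  have ind: "independent B"
    using B by (intro pairwise_orthogonal_independent) (auto simp: orthonormal_basis_of_def)
  have card: "card B = dim S"
    using dim_span_eq_card_independent[OF ind] B unfolding orthonormal_basis_of_def by metis
  have "(norm (\<Sum>b\<in>B. f b *\<^sub>R b))\<^sup>2 = (\<Sum>b\<in>B. (f b)\<^sup>2)" for f
    unfolding power2_norm_eq_inner using fin
    by (simp add: inner_sum_left inner_sum_right orthonormal_basis_of_inner[OF B]
        if_distrib power2_eq_square cong: if_cong sum.cong)
  then have "ennreal (exp (- ((norm (\<Sum>b\<in>B. f b *\<^sub>R b))\<^sup>2))) = (\<Prod>b\<in>B. ennreal (exp (- ((f b)\<^sup>2))))" for f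
    using fin by (simp add: prod_ennreal exp_sum sum_negf[symmetric])
  then show ?thesis
    using product_nn_integral_prod[OF fin, of "\<lambda>_ t. ennreal (exp (- (t\<^sup>2)))"]
    by (simp add: card)
qed

lemma coord_lborel_unique:
  fixes S :: "'a::euclidean_space set"
  assumes B: "orthonormal_basis_of S B" and C: "orthonormal_basis_of S C"
  shows "coord_lborel B = coord_lborel C"
proof (rule measure_eqI)
  show "sets (coord_lborel B) = sets (coord_lborel C)"
    by (simp add: coord_lborel_def)
next
  fix A assume "A \<in> sets (coord_lborel B)"
  then have A[measurable]: "A \<in> sets borel" by (simp add: coord_lborel_def)
  let ?P = "\<Pi>\<^sub>M b\<in>B. (lborel :: real measure)" and ?Q = "\<Pi>\<^sub>M b\<in>C. (lborel :: real measure)"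
  let ?p = "\<lambda>f. \<Sum>b\<in>B. f b *\<^sub>R b" and ?q = "\<lambda>f. \<Sum>b\<in>C. f b *\<^sub>R b"
  let ?g = "\<lambda>x::'a. ennreal (exp (- ((norm x)\<^sup>2)))"
  let ?i = "indicator A :: 'a \<Rightarrow> ennreal"
  let ?I = "(\<integral>\<^sup>+t. ennreal (exp (- (t\<^sup>2))) \<partial>(lborel :: real measure)) ^ dim S"
  interpret product_sigma_finite "\<lambda>b::'a. lborel :: real measure" ..
  have finB: "finite B" and finC: "finite C" using B C by (auto dest: orthonormal_basis_of_finite)
  interpret P: sigma_finite_measure ?P by (rule sigma_finite[OF finB])
  interpret Q: sigma_finite_measure ?Q by (rule sigma_finite[OF finC])
  interpret PQ: pair_sigma_finite ?P ?Q ..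
  have pS: "?p f \<in> S" for f
    using B unfolding orthonormal_basis_of_def by (metis (no_types, lifting) span_sum span_scale span_base)
  have qS: "?q f \<in> S" for f
    using C unfolding orthonormal_basis_of_def by (metis (no_types, lifting) span_sum span_scale span_base)
  have zS: "0 \<in> S" using B span_zero by (auto simp: orthonormal_basis_of_def)
  have mA: "emeasure (coord_lborel D) A = (\<integral>\<^sup>+f. ?i (\<Sum>b\<in>D. f b *\<^sub>R b) \<partial>(\<Pi>\<^sub>M b\<in>D. lborel))" for D
  proof -
    have "emeasure (coord_lborel D) A = (\<integral>\<^sup>+x. ?i x \<partial>coord_lborel D)"
      by (simp add: coord_lborel_def)
    also have "\<dots> = (\<integral>\<^sup>+f. ?i (\<Sum>b\<in>D. f b *\<^sub>R b) \<partial>(\<Pi>\<^sub>M b\<in>D. lborel))"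
      unfolding coord_lborel_def by (rule nn_integral_distr) measurable
    finally show ?thesis .
  qed
  have "emeasure (coord_lborel B) A * ?I = (\<integral>\<^sup>+f. ?i (?p f) * ?I \<partial>?P)"
    unfolding mA by (rule nn_integral_multc[symmetric]) measurable
  also have "\<dots> = (\<integral>\<^sup>+f. \<integral>\<^sup>+h. ?i (?p f) * ?g (?p f - ?q h) \<partial>?Q \<partial>?P)"
  proof (rule nn_integral_cong)
    fix f
    have "(\<integral>\<^sup>+h. ?g (?p f - ?q h) \<partial>?Q) = ?I"
      using coord_lborel_reflect[OF C pS, of ?g] coord_lborel_gauss[OF C] by simp
    then show "?i (?p f) * ?I = (\<integral>\<^sup>+h. ?i (?p f) * ?g (?p f - ?q h) \<partial>?Q)"
      by (subst nn_integral_cmult) auto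
  qed
  also have "\<dots> = (\<integral>\<^sup>+h. \<integral>\<^sup>+f. ?i (?p f) * ?g (?p f - ?q h) \<partial>?P \<partial>?Q)"
    by (rule PQ.Fubini'[symmetric]) measurable
  also have "\<dots> = (\<integral>\<^sup>+h. \<integral>\<^sup>+f. ?i (?q h - ?p f) * ?g (?p f) \<partial>?P \<partial>?Q)"
  proof (rule nn_integral_cong)
    fix h
    show "(\<integral>\<^sup>+f. ?i (?p f) * ?g (?p f - ?q h) \<partial>?P) = (\<integral>\<^sup>+f. ?i (?q h - ?p f) * ?g (?p f) \<partial>?P)"
      using coord_lborel_reflect[OF B qS, of "\<lambda>x. ?i x * ?g (x - ?q h)" h] by simp
  qed
  also have "\<dots> = (\<integral>\<^sup>+f. \<integral>\<^sup>+h. ?i (?q h - ?p f) * ?g (?p f) \<partial>?Q \<partial>?P)"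
    by (rule PQ.Fubini') measurable
  also have "\<dots> = (\<integral>\<^sup>+f. emeasure (coord_lborel C) A * ?g (?p f) \<partial>?P)"
  proof (rule nn_integral_cong)
    fix f
    have "(\<integral>\<^sup>+h. ?i (?q h - ?p f) \<partial>?Q) = (\<integral>\<^sup>+h. ?i (- ?q h) \<partial>?Q)"
      using coord_lborel_reflect[OF C pS, of "\<lambda>x. ?i (- x)" f] by simp
    also have "\<dots> = (\<integral>\<^sup>+h. ?i (?q h) \<partial>?Q)"
      using coord_lborel_reflect[OF C zS, of ?i] by simp
    finally show "(\<integral>\<^sup>+h. ?i (?q h - ?p f) * ?g (?p f) \<partial>?Q) = emeasure (coord_lborel C) A * ?g (?p f)"
      unfolding mA by (subst nn_integral_multc) auto
  qed
  also have "\<dots> = emeasure (coord_lborel C) A * ?I"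
    using coord_lborel_gauss[OF B] by (subst nn_integral_cmult) auto
  finally have "emeasure (coord_lborel B) A * ?I = emeasure (coord_lborel C) A * ?I" .
  moreover have "?I \<noteq> 0" "?I \<noteq> \<infinity>"
    using gauss_pos gauss_finite by (auto simp: power_eq_top_ennreal)
  ultimately show "emeasure (coord_lborel B) A = emeasure (coord_lborel C) A"
    by (metis ennreal_mult_cancel_left infinity_ennreal_def mult.commute)
qed

lemma subspace_volume_eq:
  assumes "orthonormal_basis_of S B"
  shows "subspace_volume S A = measure (coord_lborel B) A"
  using coord_lborel_unique[OF someI[of "orthonormal_basis_of S", OF assms] assms]
  by (simp add: subspace_volume_def)

lemma subspace_volume_UNIV: "subspace_volume UNIV A = measure lborel A"
proof -
  have "orthonormal_basis_of UNIV (Basis :: 'a set)"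
    by (auto simp: orthonormal_basis_of_def pairwise_def orthogonal_def inner_Basis)
  then show ?thesis
    by (simp add: subspace_volume_eq coord_lborel_def lborel_eq[symmetric])
qed


end

theory Submission
  imports Defs
begin

text \<open>
  Let \<open>M\<close> be the unit cylinder \<open>\<bar>x\<bar> \<le> 1, r \<le> 1\<close> with flat paraboloid caps \<open>\<bar>x\<bar> \<le> 1 + h (1 - r\<^sup>2)\<close>,
  let \<open>L\<close> be \<open>M\<close> with a thin ring near the rims \<open>\<bar>x\<bar> = r = 1\<close> shaved off by cones
  through the rims, and let \<open>K = c M\<close> with \<open>c < 1\<close> close to \<open>1\<close>.

  Removing the ring costs a section or a shadow most when the hyperplane contains the axis. For
  sections whose hyperplane has slope \<open>m\<close> over the axis, the loss decreases like
  \<open>(1 - m\<^sup>2) powr ((n - 4) / 2)\<close>, which for \<open>n \<ge> 5\<close> is at least as fast as the decrease of the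
  section of the cylinder. For shadows, the point where a projection line touches the parabolic cap
  is displaced by an amount independent of the line, so the loss is an off-centre slice of the ring, again
  largest in the axial case. Hence it suffices to choose \<open>c\<close> so that the dilation costs the axial
  section slightly more than the ring does. Relative to the cylinder of radius \<open>1\<close>, the ring sits
  at radius almost \<open>1\<close>, so it weighs \<open>(n - 1) / (n - 2)\<close> times more in volume than in the axial
  section, while the dilation weighs only \<open>n / (n - 1)\<close> times more. As
  \<open>n (n - 2) < (n - 1)\<^sup>2\<close>, the dilation removes less volume than the ring.
\<close>

section \<open>Lebesgue measure on subspaces\<close>

lemma emeasure_coord_lborel:
  assumes [measurable]: "A \<in> sets borel"
  shows "emeasure (coord_lborel B) A = (\<integral>\<^sup>+f. indicator A (\<Sum>b\<in>B. f b *\<^sub>R b) \<partial>(\<Pi>\<^sub>M b\<in>B. lborel))"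
proof -
  have "emeasure (coord_lborel B) A = (\<integral>\<^sup>+x. indicator A x \<partial>coord_lborel B)"
    by (simp add: coord_lborel_def)
  also have "\<dots> = (\<integral>\<^sup>+f. indicator A (\<Sum>b\<in>B. f b *\<^sub>R b) \<partial>(\<Pi>\<^sub>M b\<in>B. lborel))"
    unfolding coord_lborel_def by (rule nn_integral_distr) measurable
  finally show ?thesis .
qed

text \<open>\<open>coord_lborel B\<close> is an image measure carried by \<open>span B\<close>, so
  points outside the span may be ignored. Slices can thus be compared where their shape is
  known.\<close>

lemma emeasure_coord_lborel_mono:
  assumes "A \<in> sets borel" "A' \<in> sets borel" "A \<inter> span B \<subseteq> A'"
  shows "emeasure (coord_lborel B) A \<le> emeasure (coord_lborel B) A'"
proof -
  have "(\<Sum>b\<in>B. f b *\<^sub>R b) \<in> span B" for f :: "'a \<Rightarrow> real"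
    by (intro span_sum span_scale span_base)
  then show ?thesis
    unfolding emeasure_coord_lborel[OF assms(1)] emeasure_coord_lborel[OF assms(2)]
    using assms(3) by (intro nn_integral_mono) (auto simp: indicator_def)
qed

text \<open>Tonelli's theorem for the coordinate along \<open>f\<close>; sections, shadows and
  bodies are all compared slice by slice through it.\<close>

lemma emeasure_coord_lborel_insert:
  fixes f :: "'a::euclidean_space"
  assumes fin: "finite B" "f \<notin> B" and A[measurable]: "A \<in> sets borel"
  shows "emeasure (coord_lborel (insert f B)) A
       = (\<integral>\<^sup>+t. emeasure (coord_lborel B) ((\<lambda>w. t *\<^sub>R f + w) -` A) \<partial>lborel)"
proof -
  interpret product_sigma_finite "\<lambda>b::'a. lborel :: real measure" ..
  have m: "(\<lambda>w. t *\<^sub>R f + w) -` A \<in> sets borel" for t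
    using measurable_sets[of "\<lambda>w. t *\<^sub>R f + w" borel borel A] by simp
  have "(\<Sum>b\<in>insert f B. (h(f := t)) b *\<^sub>R b) = t *\<^sub>R f + (\<Sum>b\<in>B. h b *\<^sub>R b)" for h t
  proof -
    have "(\<Sum>b\<in>B. (h(f := t)) b *\<^sub>R b) = (\<Sum>b\<in>B. h b *\<^sub>R b)"
      using fin by (intro sum.cong) auto
    then show ?thesis using fin by simp
  qed
  then show ?thesis
    unfolding emeasure_coord_lborel[OF A] emeasure_coord_lborel[OF m]
    by (subst product_nn_integral_insert_rev[OF fin]) (auto simp: indicator_def vimage_def)
qed

lemma borel_measurable_coord_lborel_slice:
  fixes f :: "'a::euclidean_space"
  assumes fin: "finite B" and A[measurable]: "A \<in> sets borel"
  shows "(\<lambda>t. emeasure (coord_lborel B) ((\<lambda>w. t *\<^sub>R f + w) -` A)) \<in> borel_measurable borel"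
proof -
  interpret product_sigma_finite "\<lambda>b::'a. lborel :: real measure" ..
  interpret sigma_finite_measure "\<Pi>\<^sub>M b\<in>B. (lborel :: real measure)"
    using fin by (intro sigma_finite)
  have m: "(\<lambda>w. t *\<^sub>R f + w) -` A \<in> sets borel" for t
    using measurable_sets[of "\<lambda>w. t *\<^sub>R f + w" borel borel A] by simp
  show ?thesis
    unfolding emeasure_coord_lborel[OF m]
    by (simp add: indicator_def vimage_def) measurable
qed

lemma emeasure_coord_lborel_scale:
  fixes A :: "'a::euclidean_space set"
  assumes "finite B" and c: "c > 0" and "A \<in> sets borel"
  shows "emeasure (coord_lborel B) ((*\<^sub>R) c ` A) = ennreal (c ^ card B) * emeasure (coord_lborel B) A"
  using assms(1,3)
proof (induction arbitrary: A)
  have im: "(*\<^sub>R) c ` A = (\<lambda>x. x /\<^sub>R c) -` A" for A :: "'a set"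
    using c by (auto simp: image_iff intro!: bexI[of _ "_ /\<^sub>R c"])
  have ms: "(*\<^sub>R) c ` A \<in> sets borel" if "A \<in> sets borel" for A :: "'a set"
    unfolding im using measurable_sets[OF _ that, of "\<lambda>x. x /\<^sub>R c" borel] by simp
  {
    case empty
    then show ?case
      by (simp add: emeasure_coord_lborel ms) (simp add: im indicator_def)
  next
    case (insert f B)
    let ?s = "\<lambda>t. (\<lambda>w. t *\<^sub>R f + w) -` A"
    have m: "?s t \<in> sets borel" for t
      using measurable_sets[OF _ insert.prems, of "\<lambda>w. t *\<^sub>R f + w" borel] by simp
    \<comment> \<open>Coordinate \<open>t\<close> of the dilated set corresponds to coordinate
      \<open>t / c\<close> of \<open>A\<close>; substituting back contributes the one factor
      \<open>c\<close> that the induction hypothesis lacks.\<close>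
    have sl: "(\<lambda>w. t *\<^sub>R f + w) -` ((*\<^sub>R) c ` A) = (*\<^sub>R) c ` ?s (t / c)" for t
      unfolding im using c by (auto simp: algebra_simps divide_inverse)
    have meas: "(\<lambda>t. emeasure (coord_lborel B) (?s t)) \<in> borel_measurable borel"
      using insert by (intro borel_measurable_coord_lborel_slice)
    have "emeasure (coord_lborel (insert f B)) ((*\<^sub>R) c ` A)
        = (\<integral>\<^sup>+t. ennreal (c ^ card B) * emeasure (coord_lborel B) (?s (t / c)) \<partial>lborel)"
      by (simp add: emeasure_coord_lborel_insert[OF insert.hyps ms[OF insert.prems]] sl insert.IH m)
    also have "\<dots> = ennreal (c ^ card B) * (\<integral>\<^sup>+t. emeasure (coord_lborel B) (?s (t / c)) \<partial>lborel)"
      using meas by (intro nn_integral_cmult) auto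
    also have "(\<integral>\<^sup>+t. emeasure (coord_lborel B) (?s (t / c)) \<partial>lborel)
        = ennreal c * (\<integral>\<^sup>+t. emeasure (coord_lborel B) (?s t) \<partial>lborel)"
      using meas c by (subst nn_integral_real_affine[where c = c and t = 0]) auto
    also have "(\<integral>\<^sup>+t. emeasure (coord_lborel B) (?s t) \<partial>lborel) = emeasure (coord_lborel (insert f B)) A"
      by (simp add: emeasure_coord_lborel_insert[OF insert.hyps insert.prems])
    finally show ?case
      using c insert.hyps by (simp add: ennreal_mult'' mult_ac ennreal_mult)
  }
qed

section \<open>Volumes of balls in a subspace\<close>

lemma emeasure_coord_lborel_cball:
  fixes S :: "'a::euclidean_space set"
  assumes B: "orthonormal_basis_of S B" and r: "r > 0"
  shows "emeasure (coord_lborel B) (cball 0 r) = ennreal (unit_ball_vol (card B) * r ^ card B)"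
proof -
  have fin: "finite B" using B by (rule orthonormal_basis_of_finite)
  have "(norm (\<Sum>b\<in>B. f b *\<^sub>R b))\<^sup>2 = (\<Sum>b\<in>B. (f b)\<^sup>2)" for f
    unfolding power2_norm_eq_inner using fin
    by (simp add: inner_sum_left inner_sum_right orthonormal_basis_of_inner[OF B]
        if_distrib power2_eq_square cong: if_cong sum.cong)
  then have nrm: "norm (\<Sum>b\<in>B. f b *\<^sub>R b) = sqrt (\<Sum>b\<in>B. (f b)\<^sup>2)" for f
    by (intro real_sqrt_unique[symmetric] norm_ge_zero)
  have "emeasure (coord_lborel B) (cball 0 r) =
      emeasure (Pi\<^sub>M B (\<lambda>_. lborel)) ((\<lambda>f. \<Sum>b\<in>B. f b *\<^sub>R b) -` cball 0 r \<inter> space (Pi\<^sub>M B (\<lambda>_. lborel)))"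
    unfolding coord_lborel_def by (rule emeasure_distr) measurable
  also have "(\<lambda>f. \<Sum>b\<in>B. f b *\<^sub>R b) -` cball 0 r = {f. sqrt (\<Sum>i\<in>B. (f i)\<^sup>2) \<le> r}"
    by (auto simp: nrm)
  finally show ?thesis using emeasure_cball_aux[OF fin r] by simp
qed

text \<open>The volume of a \<open>k\<close>-ball of squared radius \<open>u\<close> relative to the
  unit ball. Squared radii turn an orthogonal displacement of a slice into a subtraction, and
  \<open>max 0\<close> gives empty slices volume zero when \<open>k > 0\<close>.\<close>

definition ball_radius_pow :: "nat \<Rightarrow> real \<Rightarrow> real" where
  "ball_radius_pow k u = sqrt (max 0 u) ^ k"

lemma emeasure_coord_lborel_sqball:
  fixes S :: "'a::euclidean_space set"
  assumes B: "orthonormal_basis_of S B" and k: "card B > 0"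
  shows "emeasure (coord_lborel B) {w. (norm w)\<^sup>2 \<le> u}
       = ennreal (unit_ball_vol (card B) * ball_radius_pow (card B) u)"
proof -
  consider "u > 0" | "u < 0" | "u = 0" by linarith
  then show ?thesis
  proof cases
    case 1
    then have "{w::'a. (norm w)\<^sup>2 \<le> u} = cball 0 (sqrt u)"
      by (auto simp: real_le_rsqrt sqrt_ge_absD)
    then show ?thesis
      using emeasure_coord_lborel_cball[OF B, of "sqrt u"] 1 by (simp add: ball_radius_pow_def)
  next
    case 2
    then have "{w::'a. (norm w)\<^sup>2 \<le> u} = {}"
      by (auto simp: not_le intro: less_le_trans)
    then show ?thesis using 2 k by (simp add: ball_radius_pow_def max_def)
  next
    case 3
    let ?v = "unit_ball_vol (card B)" and ?e = "emeasure (coord_lborel B) {w::'a. (norm w)\<^sup>2 \<le> u}"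
    \<comment> \<open>The degenerate ball is the origin. Its measure vanishes because it lies in
      arbitrarily small balls; \<open>card B > 0\<close> bounds \<open>r ^ card B\<close> by
      \<open>r\<close>.\<close>
    have le: "?e \<le> ennreal (?v * r)" if r: "0 < r" "r \<le> 1" for r
    proof -
      have "?e \<le> emeasure (coord_lborel B) (cball 0 r)"
        using 3 r by (intro emeasure_coord_lborel_mono) auto
      also have "\<dots> = ennreal (?v * r ^ card B)"
        by (rule emeasure_coord_lborel_cball[OF B r(1)])
      also have "\<dots> \<le> ennreal (?v * r)"
        using r k power_decreasing[of 1 "card B" r]
        by (intro ennreal_leI mult_left_mono) auto
      finally show ?thesis .
    qed
    have "?e \<le> 0"
    proof (rule ennreal_le_epsilon)
      fix x :: real assume x: "x > 0"
      have v: "?v > 0" by simp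
      have "?e \<le> ennreal (?v * min 1 (x / ?v))" using x by (intro le) auto
      also have "\<dots> \<le> ennreal x"
        using x v by (intro ennreal_leI) (simp add: min_def field_simps)
      finally show "?e \<le> 0 + ennreal x" by simp
    qed
    then show ?thesis using 3 k by (simp add: ball_radius_pow_def)
  qed
qed

lemma emeasure_coord_lborel_bounded:
  fixes S :: "'a::euclidean_space set"
  assumes B: "orthonormal_basis_of S B" and "bounded A" "A \<in> sets borel"
  shows "emeasure (coord_lborel B) A < \<infinity>"
proof -
  obtain r where r: "r > 0" "A \<subseteq> cball 0 r"
    using assms(2) unfolding bounded_pos by (auto simp: subset_iff)
  then have "emeasure (coord_lborel B) A \<le> emeasure (coord_lborel B) (cball 0 r)"
    using assms(3) by (intro emeasure_coord_lborel_mono) auto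
  also have "\<dots> < \<infinity>"
    by (simp add: emeasure_coord_lborel_cball[OF B r(1)])
  finally show ?thesis .
qed

section \<open>Powers of ball radii\<close>

lemma ball_radius_pow_nonneg [simp]: "ball_radius_pow k u \<ge> 0"
  by (simp add: ball_radius_pow_def)

lemma ball_radius_pow_mono: "v \<le> u \<Longrightarrow> ball_radius_pow k v \<le> ball_radius_pow k u"
  unfolding ball_radius_pow_def by (intro power_mono) auto

lemma ball_radius_pow_nonpos: "u \<le> 0 \<Longrightarrow> k > 0 \<Longrightarrow> ball_radius_pow k u = 0"
  by (simp add: ball_radius_pow_def max_def)

lemma ball_radius_pow_1 [simp]: "ball_radius_pow k 1 = 1"
  by (simp add: ball_radius_pow_def)

lemma continuous_on_ball_radius_pow [continuous_intros]:
  "continuous_on S f \<Longrightarrow> continuous_on S (\<lambda>x. ball_radius_pow k (f x))"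
  unfolding ball_radius_pow_def by (intro continuous_intros)

lemma borel_measurable_ball_radius_pow [measurable]: "ball_radius_pow k \<in> borel_measurable borel"
  unfolding ball_radius_pow_def by measurable

text \<open>Where the powers are positive, their derivatives are \<open>k / 2\<close> times
  \<open>sqrt (x - c) ^ (k - 2)\<close> and \<open>sqrt x ^ (k - 2)\<close>, and
  \<open>x \<le> 1\<close>, \<open>q \<le> c\<close> give \<open>x - c \<le> (1 - q) * x\<close>.
  Sections use this with \<open>q\<close> tied to the slope of the hyperplane, shadows with
  \<open>q = 0\<close>.\<close>

lemma ball_radius_pow_shift_diff:
  assumes k: "k \<ge> 2" and vu: "v \<le> u" "u \<le> 1" and q: "0 \<le> q" "q \<le> 1" "q \<le> c"
  shows "ball_radius_pow k (u - c) - ball_radius_pow k (v - c)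
       \<le> sqrt (1 - q) ^ (k - 2) * (ball_radius_pow k u - ball_radius_pow k v)"
proof (cases "u \<le> c")
  case True
  then show ?thesis
    using k vu q ball_radius_pow_mono[OF vu(1), of k]
    by (simp add: ball_radius_pow_nonpos)
next
  case False
  define s where "s = sqrt (1 - q) ^ (k - 2)"
  have s0: "s \<ge> 0" using q by (simp add: s_def)
  \<comment> \<open>Below \<open>c\<close> the shifted power vanishes while the unshifted one does
    not decrease, so derivatives need to be compared only from \<open>max v c\<close>
    upwards.\<close>
  define v' where "v' = max v c"
  have v': "v' \<le> u" "c \<le> v'" "v \<le> v'" using False vu by (auto simp: v'_def)
  let ?h = "\<lambda>x. s * sqrt x ^ k - sqrt (x - c) ^ k"
  have "?h v' \<le> ?h u"
  proof (rule DERIV_nonneg_imp_increasing_open[OF v'(1)])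
    fix x assume x: "v' < x" "x < u"
    have pos: "x > 0" "x - c > 0" using x v' q by auto
    have d: "((\<lambda>x. sqrt (x - a) ^ k) has_real_derivative (real k / 2) * sqrt (x - a) ^ (k - 2)) (at x)"
      if "x - a > 0" for a
    proof -
      have "k - 1 = Suc (k - 2)" using k by simp
      then have "real k * (sqrt (x - a) ^ (k - 1) * (inverse (sqrt (x - a)) / 2))
          = (real k / 2) * sqrt (x - a) ^ (k - 2)"
        using that by (simp add: field_simps)
      moreover have "((\<lambda>x. sqrt (x - a) ^ k) has_real_derivative
          real k * (sqrt (x - a) ^ (k - 1) * (inverse (sqrt (x - a)) / 2))) (at x)"
        using that by (auto intro!: derivative_eq_intros)
      ultimately show ?thesis by (simp only:)
    qed
    have "((\<lambda>x. s * sqrt x ^ k - sqrt (x - c) ^ k) has_real_derivative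
        s * ((real k / 2) * sqrt x ^ (k - 2)) - (real k / 2) * sqrt (x - c) ^ (k - 2)) (at x)"
      using DERIV_diff[OF DERIV_cmult[OF d[of 0]] d[of c]] pos by simp
    moreover have "sqrt (x - c) ^ (k - 2) \<le> s * sqrt x ^ (k - 2)"
    proof -
      have "x * q \<le> q * 1" using x vu q pos by (subst mult.commute, intro mult_left_mono) auto
      then have "x - c \<le> (1 - q) * x" using q by (simp add: algebra_simps)
      then have "sqrt (x - c) \<le> sqrt (1 - q) * sqrt x"
        by (metis real_sqrt_le_mono real_sqrt_mult)
      then have "sqrt (x - c) ^ (k - 2) \<le> (sqrt (1 - q) * sqrt x) ^ (k - 2)"
        using pos by (intro power_mono) auto
      then show ?thesis by (simp add: s_def power_mult_distrib)
    qed
    then have "s * ((real k / 2) * sqrt x ^ (k - 2)) - (real k / 2) * sqrt (x - c) ^ (k - 2) \<ge> 0"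
      using mult_left_mono[of "sqrt (x - c) ^ (k - 2)" "s * sqrt x ^ (k - 2)" "real k / 2"]
      by (simp add: mult_ac)
    ultimately show "\<exists>y. DERIV ?h x :> y \<and> y \<ge> 0" by blast
  next
    show "continuous_on {v'..u} ?h" by (intro continuous_intros)
  qed
  moreover have "ball_radius_pow k x = sqrt x ^ k" "ball_radius_pow k (x - c) = sqrt (x - c) ^ k"
    if "x \<ge> c" for x
    using that q by (auto simp: ball_radius_pow_def)
  ultimately have *: "s * ball_radius_pow k v' - ball_radius_pow k (v' - c)
      \<le> s * ball_radius_pow k u - ball_radius_pow k (u - c)"
    using v' by simp
  have "s * ball_radius_pow k v \<le> s * ball_radius_pow k v'"
    using s0 v' by (intro mult_left_mono ball_radius_pow_mono)
  moreover have "ball_radius_pow k (v' - c) = ball_radius_pow k (v - c)"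
    using k by (cases "v \<le> c") (auto simp: v'_def ball_radius_pow_nonpos)
  ultimately show ?thesis using * by (simp add: s_def algebra_simps)
qed

text \<open>A lower bound for the section of the cylinder by a hyperplane of slope
  \<open>sqrt q\<close>. Of the \<open>k\<close> factors, \<open>k - 3\<close> are bounded by their
  minimum \<open>sqrt (1 - q)\<close>; Jensen's inequality handles the remaining cube, and
  \<open>(1 - q / 3) ^ 3 \<ge> 1 - q\<close> finishes. This is where dimension at least 5 enters:
  for \<open>k = 2\<close> the lower bound would be 2 and would fail as soon as
  \<open>q > 0\<close>.\<close>

lemma integral_sqrt_pow_ge:
  assumes k: "k \<ge> 3" and q: "0 \<le> q" "q < 1"
  shows "(\<integral>\<^sup>+x. ennreal (ball_radius_pow k (1 - q * x\<^sup>2)) * indicator {-1..1} x \<partial>lborel)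
       \<ge> ennreal (2 * sqrt (1 - q) ^ (k - 2))"
proof -
  define b where "b = sqrt (1 - q / 3)"
  have b: "b > 0" "b\<^sup>2 = 1 - q / 3" using q by (auto simp: b_def)
  define r where "r = sqrt (1 - q)"
  have r: "r > 0" "r\<^sup>2 = 1 - q" using q by (auto simp: r_def)
  have rb: "r \<le> b ^ 3"
  proof (rule power2_le_imp_le)
    have "(b ^ 3)\<^sup>2 = (1 - q / 3) ^ 3" using b(2) by (metis power_mult mult.commute)
    also have "\<dots> \<ge> 1 - q"
    proof -
      have "(1 - q / 3) ^ 3 - (1 - q) = q\<^sup>2 * (9 - q) / 27"
        by (simp add: field_simps power2_eq_square power3_eq_cube)
      then show ?thesis using q by (smt (verit) divide_nonneg_pos mult_nonneg_nonneg zero_le_power2)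
    qed
    finally show "r\<^sup>2 \<le> (b ^ 3)\<^sup>2" using r by simp
  qed (use b in auto)
  let ?g = "\<lambda>x. r ^ (k - 3) * (3 / 2 * b * (1 - q * x\<^sup>2) - b ^ 3 / 2)"
  \<comment> \<open>The tangent line of \<open>t \<mapsto> t powr (3/2)\<close> at the mean value \<open>b\<^sup>2\<close> of \<open>1 - q * x\<^sup>2\<close>.\<close>
  have pt: "?g x \<le> ball_radius_pow k (1 - q * x\<^sup>2)" if x: "x \<in> {-1..1}" for x
  proof -
    define s where "s = sqrt (1 - q * x\<^sup>2)"
    have "x\<^sup>2 \<le> 1" using x by (simp add: abs_square_le_1 abs_le_iff)
    then have le: "q * x\<^sup>2 \<le> q" using q mult_left_mono[of "x\<^sup>2" 1 q] by simp
    then have s: "s\<^sup>2 = 1 - q * x\<^sup>2" "s \<ge> r" "s > 0"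
      using q by (auto simp: s_def r_def)
    have "2 * s ^ 3 + b ^ 3 - 3 * s\<^sup>2 * b = (s - b)\<^sup>2 * (2 * s + b)"
      by (simp add: power2_eq_square power3_eq_cube algebra_simps)
    also have "\<dots> \<ge> 0" using s b by simp
    finally have "3 / 2 * b * s\<^sup>2 - b ^ 3 / 2 \<le> s ^ 3" by (simp add: field_simps)
    then have "?g x \<le> r ^ (k - 3) * s ^ 3"
      unfolding s(1)[symmetric] using r(1) by (intro mult_left_mono zero_le_power) linarith+
    also have "\<dots> \<le> s ^ (k - 3) * s ^ 3"
      using r(1) s(2,3) by (intro mult_right_mono power_mono zero_le_power) linarith+
    also have "\<dots> = s ^ k" using k by (simp flip: power_add)
    also have "s ^ k = ball_radius_pow k (1 - q * x\<^sup>2)"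
      using le q by (simp add: ball_radius_pow_def s_def max_def)
    finally show ?thesis .
  qed
  let ?G = "\<lambda>x. r ^ (k - 3) * (3 / 2 * b * (x - q * x ^ 3 / 3) - b ^ 3 / 2 * x)"
  let ?P = "\<lambda>x. ball_radius_pow k (1 - q * x\<^sup>2)"
  have "(?g has_integral (?G 1 - ?G (-1))) {-1..1}"
  proof (rule fundamental_theorem_of_calculus)
    fix x :: real
    have "(?G has_real_derivative r ^ (k - 3) * (3 / 2 * b * (1 - q * (3 * x\<^sup>2) / 3) - b ^ 3 / 2 * 1)) (at x)"
      by (auto intro!: derivative_eq_intros simp: numeral_2_eq_2)
    then show "(?G has_vector_derivative ?g x) (at x within {-1..1})"
      by (simp add: has_real_derivative_iff_has_vector_derivative has_vector_derivative_at_within)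
  qed simp
  also have "?G 1 - ?G (-1) = r ^ (k - 3) * (3 * b * (1 - q / 3) - b ^ 3)"
    by (simp add: field_simps)
  also have "3 * b * (1 - q / 3) - b ^ 3 = 2 * b ^ 3"
    unfolding b(2)[symmetric] by (simp add: power3_eq_cube power2_eq_square)
  finally have gi: "(?g has_integral (r ^ (k - 3) * (2 * b ^ 3))) {-1..1}" .
  have "continuous_on {-1..1} ?P" by (intro continuous_intros)
  then have int: "?P integrable_on {-1..1}" by (rule integrable_continuous_real)
  have "2 * r ^ (k - 2) \<le> r ^ (k - 3) * (2 * b ^ 3)"
  proof -
    have "k - 2 = Suc (k - 3)" using k by simp
    then show ?thesis
      using mult_left_mono[OF rb, of "2 * r ^ (k - 3)"] r(1) by (simp add: mult_ac)
  qed
  also have "\<dots> \<le> integral {-1..1} ?P"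
    by (rule has_integral_le[OF gi integrable_integral[OF int] pt])
  finally have "ennreal (2 * r ^ (k - 2)) \<le> ennreal (integral {-1..1} ?P)"
    by (rule ennreal_leI)
  also have "\<dots> = (\<integral>\<^sup>+x. ennreal (indicator {-1..1} x * ?P x) \<partial>lborel)"
    by (rule nn_integral_has_integral_lebesgue[OF _ integrable_integral[OF int], symmetric]) simp
  finally show ?thesis
    by (simp add: r_def ennreal_mult' ennreal_indicator mult.commute)
qed

section \<open>The two profiles\<close>

text \<open>Profiles give the squared radius of a slice orthogonal to the axis; negative values stand for
  empty slices.\<close>

definition cap_profile :: "real \<Rightarrow> real \<Rightarrow> real" where
  "cap_profile h x = min 1 (1 - (\<bar>x\<bar> - 1) / h)"

text \<open>The second term is the cone \<open>\<bar>x\<bar> \<le> 1 + h * (2 - d) * (1 - r)\<close>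
  solved for \<open>r\<close> and squared. At the rim it is slightly flatter than the parabolic cap,
  whose slope there is \<open>2 * h\<close>, so for \<open>0 < d < 1\<close> it shaves the cap
  exactly at radii between \<open>1 - d\<close> and 1. Past the apex of the cone the square grows
  again, but there \<open>cap_profile\<close> is already negative.\<close>

definition shaved_profile :: "real \<Rightarrow> real \<Rightarrow> real \<Rightarrow> real" where
  "shaved_profile h d x = min (cap_profile h x) ((1 - (\<bar>x\<bar> - 1) / (h * (2 - d)))\<^sup>2)"

text \<open>Up to the factor \<open>unit_ball_vol k\<close>, the volume that the ring takes from the
  \<open>k\<close>-dimensional slice at \<open>x\<close>: in dimension \<open>n\<close>,
  \<open>k = n - 2\<close> belongs to the axial section and \<open>k = n - 1\<close> to the
  body.\<close>

definition profile_gap :: "nat \<Rightarrow> real \<Rightarrow> real \<Rightarrow> real \<Rightarrow> real" where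
  "profile_gap k h d x = ball_radius_pow k (cap_profile h x) - ball_radius_pow k (shaved_profile h d x)"

lemma cap_profile_minus [simp]: "cap_profile h (- x) = cap_profile h x"
  by (simp add: cap_profile_def)

lemma shaved_profile_minus [simp]: "shaved_profile h d (- x) = shaved_profile h d x"
  by (simp add: shaved_profile_def)

lemma profile_gap_minus [simp]: "profile_gap k h d (- x) = profile_gap k h d x"
  by (simp add: profile_gap_def)

lemma shaved_le_cap_profile: "shaved_profile h d x \<le> cap_profile h x"
  by (simp add: shaved_profile_def)

lemma cap_profile_le_1: "cap_profile h x \<le> 1"
  by (simp add: cap_profile_def)

lemma profile_gap_nonneg: "profile_gap k h d x \<ge> 0"
  by (simp add: profile_gap_def ball_radius_pow_mono shaved_le_cap_profile)

lemma continuous_on_cap_profile: "continuous_on S (cap_profile h)"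
  unfolding cap_profile_def divide_inverse by (intro continuous_intros)

lemma continuous_on_shaved_profile: "continuous_on S (shaved_profile h d)"
  unfolding shaved_profile_def divide_inverse
  by (intro continuous_intros continuous_on_cap_profile)

lemma borel_measurable_cap_profile [measurable]: "cap_profile h \<in> borel_measurable borel"
  by (intro borel_measurable_continuous_onI continuous_on_cap_profile)

lemma borel_measurable_shaved_profile [measurable]: "shaved_profile h d \<in> borel_measurable borel"
  by (intro borel_measurable_continuous_onI continuous_on_shaved_profile)

lemma continuous_on_profile_gap: "continuous_on S (profile_gap k h d)"
  unfolding profile_gap_def
  by (intro continuous_intros continuous_on_cap_profile continuous_on_shaved_profile)

lemma borel_measurable_profile_gap [measurable]: "profile_gap k h d \<in> borel_measurable borel"
  by (intro borel_measurable_continuous_onI continuous_on_profile_gap)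

lemma cap_profile_eq_1: "h > 0 \<Longrightarrow> \<bar>x\<bar> \<le> 1 \<Longrightarrow> cap_profile h x = 1"
  by (simp add: cap_profile_def min_def divide_nonpos_pos)

lemma shaved_profile_eq_1:
  assumes "h > 0" "d < 2" "\<bar>x\<bar> \<le> 1"
  shows "shaved_profile h d x = 1"
proof -
  have "(\<bar>x\<bar> - 1) / (h * (2 - d)) \<le> 0"
    using assms by (simp add: divide_nonpos_pos)
  then have "1\<^sup>2 \<le> (1 - (\<bar>x\<bar> - 1) / (h * (2 - d)))\<^sup>2"
    by (intro power_mono) auto
  then show ?thesis using assms by (simp add: shaved_profile_def cap_profile_eq_1)
qed

lemma cap_profile_nonpos:
  assumes "h > 0" "\<bar>x\<bar> \<ge> 1 + h"
  shows "cap_profile h x \<le> 0"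
proof -
  have "(\<bar>x\<bar> - 1) / h \<ge> 1" using assms by simp
  then show ?thesis by (simp add: cap_profile_def)
qed

lemma profile_gap_eq_0:
  assumes "h > 0" "d < 2" "k > 0" "\<bar>x\<bar> \<le> 1 \<or> \<bar>x\<bar> \<ge> 1 + h"
  shows "profile_gap k h d x = 0"
  using assms(4)
proof
  assume "\<bar>x\<bar> \<le> 1"
  then show ?thesis using assms by (simp add: profile_gap_def cap_profile_eq_1 shaved_profile_eq_1)
next
  assume "\<bar>x\<bar> \<ge> 1 + h"
  then have "cap_profile h x \<le> 0" using assms by (intro cap_profile_nonpos)
  moreover have "shaved_profile h d x \<le> cap_profile h x" by (rule shaved_le_cap_profile)
  ultimately show ?thesis using assms by (simp add: profile_gap_def ball_radius_pow_nonpos)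
qed

lemma profile_gap_le_1: "profile_gap k h d x \<le> 1"
proof -
  have "ball_radius_pow k (cap_profile h x) \<le> ball_radius_pow k 1"
    by (intro ball_radius_pow_mono cap_profile_le_1)
  then show ?thesis
    using ball_radius_pow_nonneg[of k "shaved_profile h d x"]
    unfolding profile_gap_def ball_radius_pow_1 by linarith
qed

text \<open>The difference of the two sides, as a function of the radius, has derivative
  \<open>(k + 1) * x ^ (k - 1) * (x - r)\<close>, nonnegative from \<open>r\<close> on. Mass at
  radius at least \<open>r\<close> thus weighs at least \<open>r * (k + 1) / k\<close> times as much
  one dimension higher.\<close>

lemma power_Suc_diff_ge:
  fixes a b r :: real
  assumes "0 \<le> r" "r \<le> b" "b \<le> a" "k > 0"
  shows "r * (real (Suc k) / real k) * (a ^ k - b ^ k) \<le> a ^ Suc k - b ^ Suc k"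
proof -
  let ?h = "\<lambda>x. x ^ Suc k - r * (real (Suc k) / real k) * x ^ k"
  have "?h b \<le> ?h a"
  proof (rule DERIV_nonneg_imp_nondecreasing[OF assms(3)])
    fix x assume x: "b \<le> x" "x \<le> a"
    have "(?h has_real_derivative
        real (Suc k) * x ^ k - r * (real (Suc k) / real k) * (real k * x ^ (k - 1))) (at x)"
      by (intro DERIV_diff DERIV_cmult DERIV_pow[of "Suc k", simplified] DERIV_pow[of k, simplified])
         (use DERIV_pow[of "Suc k" x UNIV] DERIV_pow[of k x UNIV] in auto)
    moreover have "real (Suc k) * x ^ k - r * (real (Suc k) / real k) * (real k * x ^ (k - 1))
        = real (Suc k) * x ^ (k - 1) * (x - r)"
      using assms(4) by (cases k) (auto simp: field_simps)
    moreover have "\<dots> \<ge> 0" using x assms by simp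
    ultimately show "\<exists>y. DERIV ?h x :> y \<and> y \<ge> 0" by auto
  qed
  then show ?thesis unfolding right_diff_distrib by linarith
qed

text \<open>The ring lies at radii above \<open>1 - d\<close>, so \<open>power_Suc_diff_ge\<close>
  applies with \<open>r = 1 - d\<close>. This is the advantage of the volume over the axial
  section.\<close>

lemma profile_gap_Suc_ge:
  assumes h: "h > 0" and d: "0 < d" "d < 1" and k: "k > 0"
  shows "(1 - d) * (real (Suc k) / real k) * profile_gap k h d x \<le> profile_gap (Suc k) h d x"
proof (cases "cap_profile h x \<le> 0 \<or> shaved_profile h d x = cap_profile h x")
  case True
  then have "profile_gap k h d x = 0"
    using k shaved_le_cap_profile[of h d x] by (auto simp: profile_gap_def ball_radius_pow_nonpos)
  then show ?thesis by (simp add: profile_gap_nonneg)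
next
  case False
  define z where "z = (\<bar>x\<bar> - 1) / h"
  have z1: "z < 1" using False by (auto simp: cap_profile_def z_def)
  have z0: "z > 0"
  proof (rule ccontr)
    assume "\<not> z > 0"
    then have "\<bar>x\<bar> \<le> 1" using h by (simp add: z_def zero_less_divide_iff)
    then show False using False h d by (simp add: cap_profile_eq_1 shaved_profile_eq_1)
  qed
  define y where "y = z / (2 - d)"
  have sh: "shaved_profile h d x = min (1 - z) ((1 - y)\<^sup>2)" and cp: "cap_profile h x = 1 - z"
    using z0 by (auto simp: shaved_profile_def cap_profile_def z_def y_def)
  have zy: "z = y * (2 - d)" and y0: "y > 0" using d z0 by (auto simp: y_def)
  \<comment> \<open>In terms of the cone radius \<open>1 - y\<close>, the cone is strictly inside
    the cap precisely for \<open>0 < y < d\<close>.\<close>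
  have lt: "(1 - y)\<^sup>2 < 1 - z" using False sh cp by auto
  then have "y * y < y * d" by (simp add: zy power2_eq_square algebra_simps)
  then have yd: "y < d" using y0 by simp
  let ?a = "sqrt (1 - z)"
  have "(1 - d) * (real (Suc k) / real k) * (?a ^ k - (1 - y) ^ k) \<le> ?a ^ Suc k - (1 - y) ^ Suc k"
    using d k yd lt by (intro power_Suc_diff_ge) (auto intro: real_le_rsqrt)
  moreover have "sqrt (max 0 (shaved_profile h d x)) = 1 - y" "sqrt (max 0 (cap_profile h x)) = ?a"
    using lt z1 yd d by (auto simp: sh cp min_def max_def)
  ultimately show ?thesis unfolding profile_gap_def ball_radius_pow_def by simp
qed

text \<open>For \<open>k = n - 2\<close> the number \<open>E\<close> is the loss of the axial
  section in units of \<open>unit_ball_vol k\<close>, the common yardstick for sections, shadows and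
  volume. The upper bound holds because the gap is at most 1 and lives on
  \<open>1 \<le> \<bar>x\<bar> \<le> 1 + h\<close>.\<close>

lemma nn_integral_profile_gap:
  assumes h: "h > 0" and d: "0 < d" "d < 1" and k: "k > 0"
  obtains E where "(\<integral>\<^sup>+x. ennreal (profile_gap k h d x) \<partial>lborel) = ennreal E" "0 < E" "E \<le> 2 * h"
proof -
  let ?I = "\<integral>\<^sup>+x. ennreal (profile_gap k h d x) \<partial>lborel"
  have "?I \<le> (\<integral>\<^sup>+x. indicator {1..1 + h} x + indicator {-(1 + h)..-1} x \<partial>lborel)"
  proof (rule nn_integral_mono)
    fix x :: real
    show "ennreal (profile_gap k h d x) \<le> indicator {1..1 + h} x + indicator {-(1 + h)..-1} x"
    proof (cases "\<bar>x\<bar> \<le> 1 \<or> \<bar>x\<bar> \<ge> 1 + h")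
      case True
      then show ?thesis using profile_gap_eq_0[of h d k x] assms by simp
    next
      case False
      then have "x \<in> {1..1 + h} \<or> x \<in> {-(1 + h)..-1}" by auto
      then have "(1::ennreal) \<le> indicator {1..1 + h} x + indicator {-(1 + h)..-1} x"
        by (auto simp: indicator_def)
      moreover have "ennreal (profile_gap k h d x) \<le> 1"
        using profile_gap_le_1[of k h d x] by (simp add: ennreal_le_1)
      ultimately show ?thesis by (rule order_trans[rotated])
    qed
  qed
  also have "\<dots> = ennreal (2 * h)"
    using h by (subst nn_integral_add) (auto simp flip: ennreal_plus)
  finally have le: "?I \<le> ennreal (2 * h)" .
  have pos: "?I > 0"
  proof -
    \<comment> \<open>The point where the cone has radius \<open>1 - d / 2\<close>, in the middle of
      the ring's range of cone radii; continuity spreads the positive gap at \<open>x0\<close> to an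
      interval.\<close>
    define z where "z = d * (2 - d) / 2"
    define x0 where "x0 = 1 + h * z"
    have z: "0 < z" "z < 1"
    proof -
      show "0 < z" using d by (simp add: z_def)
      have "d * (2 - d) = 1 - (1 - d)\<^sup>2" by (simp add: power2_eq_square algebra_simps)
      then have "d * (2 - d) \<le> 1" by simp
      then show "z < 1" by (simp add: z_def)
    qed
    have A: "(\<bar>x0\<bar> - 1) / h = z" using z h by (simp add: x0_def)
    have B: "(\<bar>x0\<bar> - 1) / (h * (2 - d)) = d / 2"
    proof -
      have "\<bar>x0\<bar> - 1 = (d / 2) * (h * (2 - d))" using z h by (simp add: x0_def) (simp add: z_def)
      then show ?thesis using h d by simp
    qed
    have "cap_profile h x0 = 1 - z" "shaved_profile h d x0 = min (1 - z) ((1 - d / 2)\<^sup>2)"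
      unfolding cap_profile_def shaved_profile_def A B using z by simp_all
    moreover have "(1 - d / 2)\<^sup>2 < 1 - z"
    proof -
      have "1 - z - (1 - d / 2)\<^sup>2 = d\<^sup>2 / 4"
        by (simp add: z_def power2_eq_square field_simps)
      moreover have "d\<^sup>2 / 4 > 0" using d by simp
      ultimately show ?thesis by linarith
    qed
    moreover have "(1 - d / 2)\<^sup>2 \<ge> 0" by simp
    ultimately have gap: "profile_gap k h d x0 > 0"
      using k z by (auto simp: profile_gap_def ball_radius_pow_def min_def max_def
          intro!: power_strict_mono real_less_rsqrt)
    define m where "m = profile_gap k h d x0 / 2"
    have m: "m > 0" using gap by (simp add: m_def)
    have "isCont (profile_gap k h d) x0"
      using continuous_on_profile_gap[of UNIV k h d] by (simp add: continuous_on_eq_continuous_at)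
    then have "\<forall>\<^sub>F x in nhds x0. profile_gap k h d x > m"
      using gap by (intro order_tendstoD(1)[of _ "profile_gap k h d x0"])
        (auto simp: m_def isCont_def tendsto_at_iff_tendsto_nhds)
    then obtain r where r: "r > 0" "\<And>x. dist x x0 < r \<Longrightarrow> profile_gap k h d x > m"
      unfolding eventually_nhds_metric by blast
    have "0 < ennreal (m * r)" using m r by simp
    also have "\<dots> = (\<integral>\<^sup>+x. ennreal m * indicator {x0 - r / 2..x0 + r / 2} x \<partial>lborel)"
      using m r by (subst nn_integral_cmult_indicator) (auto simp flip: ennreal_mult)
    also have "\<dots> \<le> ?I"
    proof (rule nn_integral_mono)
      fix x
      show "ennreal m * indicator {x0 - r / 2..x0 + r / 2} x \<le> ennreal (profile_gap k h d x)"
      proof (cases "x \<in> {x0 - r / 2..x0 + r / 2}")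
        case True
        then have "dist x x0 < r" using r(1) by (auto simp: dist_real_def)
        then show ?thesis using True r(2)[of x] by (auto intro: ennreal_leI)
      qed simp
    qed
    finally show ?thesis .
  qed
  obtain E where E: "?I = ennreal E" "E \<ge> 0"
    using le by (metis ennreal_cases ennreal_neq_top leD top.not_eq_extremum)
  show ?thesis
  proof (rule that[OF E(1)])
    show "0 < E" using pos E by simp
    show "E \<le> 2 * h" using le E h by simp
  qed
qed

section \<open>Slices of shadows and the choice of parameters\<close>

text \<open>Here \<open>y = s / (2 * h * c)\<close> is where a line \<open>c * x + s * y = t\<close> touches a parabola
  \<open>x = const - h * y\<^sup>2\<close>.\<close>

lemma shadow_slice_same:
  fixes c s h d x y :: real
  assumes h: "h > 0" and d: "0 < d" "d < 1" and cs: "c > 0" "s \<ge> 0"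
    and t: "\<bar>c * x + s * y\<bar> \<le> c + s * (s / (2 * h * c))"
    and le: "y\<^sup>2 + w \<le> cap_profile h x"
  shows "\<exists>x' y'. c * x' + s * y' = c * x + s * y \<and> y'\<^sup>2 + w \<le> shaved_profile h d x'"
proof -
  \<comment> \<open>Both profiles are even, so reflecting \<open>(x, y)\<close> in the origin
    reduces everything to a nonnegative value of \<open>c * x + s * y\<close>. A point over a cap is
    slid along its line to the cylinder, where the two profiles agree.\<close>
  have *: "\<exists>x' y'. c * x' + s * y' = c * x + s * y \<and> y'\<^sup>2 + w \<le> shaved_profile h d x'"
    if t: "0 \<le> c * x + s * y" "c * x + s * y \<le> c + s * (s / (2 * h * c))"
      and le: "y\<^sup>2 + w \<le> cap_profile h x" for x y
  proof (cases "\<bar>x\<bar> \<le> 1")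
    case True
    then show ?thesis
      using le h d by (intro exI[of _ x] exI[of _ y]) (simp add: shaved_profile_eq_1 cap_profile_eq_1)
  next
    case False
    have le1: "y\<^sup>2 + w \<le> 1" and le2: "y\<^sup>2 + w \<le> 1 - (\<bar>x\<bar> - 1) / h"
      using le by (auto simp: cap_profile_def)
    have spos: "s > 0"
    proof (rule ccontr)
      assume "\<not> s > 0"
      then have "s = 0" using cs by simp
      then have "0 \<le> c * x" "c * x \<le> c * 1" using t by auto
      then have "0 \<le> x" "x \<le> 1" using cs by (auto simp: zero_le_mult_iff)
      then show False using False by simp
    qed
    show ?thesis
    proof (cases "x > 0")
      case True
      then have x: "x > 1" using False by simp
      \<comment> \<open>Slide to the rim \<open>x = 1\<close>. The bound on the line keeps
        \<open>y'\<close> at most the tangency value, so \<open>y\<^sup>2\<close> grows by at most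
        \<open>(x - 1) / h\<close>, which is what the cap profile gains on the way from
        \<open>x\<close> back to 1.\<close>
      define y' where "y' = y + c * (x - 1) / s"
      have e: "c * 1 + s * y' = c * x + s * y"
        using spos by (simp add: y'_def field_simps)
      have "s * y' \<le> s * (s / (2 * h * c))" using t(2) e by linarith
      then have y'le: "y' \<le> s / (2 * h * c)" using spos by (rule mult_left_le_imp_le)
      have "y'\<^sup>2 - y\<^sup>2 = (c * (x - 1) / s) * (2 * y' - c * (x - 1) / s)"
        unfolding y'_def power2_eq_square by algebra
      also have "\<dots> \<le> (c * (x - 1) / s) * (s / (h * c))"
      proof (rule mult_left_mono)
        have "c * (x - 1) / s \<ge> 0" using x cs by simp
        moreover have "2 * y' \<le> s / (h * c)" using mult_left_mono[OF y'le, of 2] by simp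
        ultimately show "2 * y' - c * (x - 1) / s \<le> s / (h * c)" by simp
      qed (use x cs in simp)
      also have "\<dots> = (\<bar>x\<bar> - 1) / h" using spos cs h x by simp
      finally have "y'\<^sup>2 + w \<le> 1" using le2 by simp
      then show ?thesis
        using e h d by (intro exI[of _ 1] exI[of _ y']) (simp add: shaved_profile_eq_1)
    next
      case neg: False
      then have x: "x < -1" using False by simp
      \<comment> \<open>On the far side the slide to \<open>x = -1\<close> decreases
        \<open>y\<close>, and \<open>0 \<le> c * x + s * y\<close> keeps it positive, so
        \<open>y\<^sup>2\<close> does not grow.\<close>
      define y' where "y' = y + c * (x + 1) / s"
      have e: "c * (-1) + s * y' = c * x + s * y"
        using spos by (simp add: y'_def field_simps)
      have "s * y' \<ge> c" using e t(1) by simp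
      then have "y' > 0" using cs spos by (smt (verit) mult_nonneg_nonpos)
      moreover have "y' \<le> y" using x cs spos by (simp add: y'_def mult_nonneg_nonpos divide_nonpos_pos)
      ultimately have "y'\<^sup>2 \<le> y\<^sup>2" by (intro power_mono) auto
      then have "y'\<^sup>2 + w \<le> 1" using le1 by simp
      then show ?thesis
        using e h d by (intro exI[of _ "-1"] exI[of _ y']) (simp add: shaved_profile_eq_1)
    qed
  qed
  show ?thesis
  proof (cases "0 \<le> c * x + s * y")
    case True
    then show ?thesis using * t le by simp
  next
    case False
    then obtain x' y' where "c * x' + s * y' = c * (- x) + s * (- y)" "y'\<^sup>2 + w \<le> shaved_profile h d x'"
      using *[of "-x" "-y"] t le by auto
    then show ?thesis by (intro exI[of _ "- x'"] exI[of _ "- y'"]) auto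
  qed
qed

text \<open>Along the line the parabolic constraint leaves most room for \<open>w\<close> at the
  tangency point, by \<open>2 * j * \<bar>y\<bar> \<le> y\<^sup>2 + j\<^sup>2\<close> with
  \<open>j = s / (2 * h * c)\<close>. Since \<open>j\<close> is the same for all parallel lines, the
  shadow slice is governed by the profile at a displaced abscissa, lowered by the constant
  \<open>j\<^sup>2\<close>.\<close>

lemma shadow_slice_upper:
  fixes c s h x y :: real
  assumes h: "h > 0" and cs: "c > 0" "s \<ge> 0"
    and t: "\<bar>c * x + s * y\<bar> \<ge> c + s * (s / (2 * h * c))"
    and le: "y\<^sup>2 + w \<le> cap_profile h x"
  shows "w \<le> cap_profile h ((\<bar>c * x + s * y\<bar> - s * (s / (2 * h * c))) / c) - (s / (2 * h * c))\<^sup>2"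
proof -
  define j where "j = s / (2 * h * c)"
  define z where "z = (\<bar>c * x + s * y\<bar> - s * j) / c"
  have z: "c * z = \<bar>c * x + s * y\<bar> - s * j" using cs by (simp add: z_def)
  have sj: "s = 2 * h * c * j" using h cs by (simp add: j_def)
  have j0: "j \<ge> 0" using h cs by (simp add: j_def)
  have z1: "z \<ge> 1" using t cs by (simp add: z_def j_def)
  have le2: "y\<^sup>2 + w \<le> 1 - (\<bar>x\<bar> - 1) / h" using le by (auto simp: cap_profile_def)
  have "c * (z + 2 * h * j * j) \<le> c * (\<bar>x\<bar> + 2 * h * j * \<bar>y\<bar>)"
  proof -
    have "c * z + s * j = \<bar>c * x + s * y\<bar>" by (simp add: z)
    also have "\<dots> \<le> c * \<bar>x\<bar> + s * \<bar>y\<bar>"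
      using cs abs_triangle_ineq[of "c * x" "s * y"] by (simp add: abs_mult)
    finally show ?thesis unfolding sj by (simp add: algebra_simps)
  qed
  then have "z + 2 * h * j * j \<le> \<bar>x\<bar> + 2 * h * j * \<bar>y\<bar>" using cs by simp
  then have "(z - 1 + h * (2 * j * j)) / h \<le> (\<bar>x\<bar> - 1 + h * (2 * j * \<bar>y\<bar>)) / h"
    using h by (intro divide_right_mono) (auto simp: mult_ac)
  then have "(z - 1) / h + 2 * j * j \<le> (\<bar>x\<bar> - 1) / h + 2 * j * \<bar>y\<bar>"
    using h unfolding add_divide_distrib by simp
  moreover have "0 \<le> (\<bar>y\<bar> - j)\<^sup>2" by simp
  then have "2 * j * \<bar>y\<bar> \<le> y\<^sup>2 + j\<^sup>2" by (simp add: power2_diff algebra_simps)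
  ultimately have "w \<le> 1 - (z - 1) / h - j\<^sup>2"
    using le2 by (simp add: power2_eq_square)
  moreover have "cap_profile h z = 1 - (z - 1) / h"
    using z1 h by (simp add: cap_profile_def)
  ultimately show ?thesis by (simp add: z_def j_def)
qed

text \<open>For the shaved body the same tangency point serves merely as a witness; only a lower
  bound for its shadow is required.\<close>

lemma shadow_slice_lower:
  fixes c s h d t :: real
  assumes cs: "c > 0"
    and le: "w \<le> shaved_profile h d ((\<bar>t\<bar> - s * (s / (2 * h * c))) / c) - (s / (2 * h * c))\<^sup>2"
  shows "\<exists>x y. c * x + s * y = t \<and> y\<^sup>2 + w \<le> shaved_profile h d x"
proof -
  let ?j = "s / (2 * h * c)"
  let ?z = "(\<bar>t\<bar> - s * ?j) / c"
  have e: "c * ?z + s * ?j = \<bar>t\<bar>" using cs by simp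
  have le': "?j\<^sup>2 + w \<le> shaved_profile h d ?z" using le by simp
  show ?thesis
  proof (cases "t \<ge> 0")
    case True
    then show ?thesis using e le' by (intro exI[of _ ?z] exI[of _ ?j]) simp
  next
    case False
    have "c * (- ?z) + s * (- ?j) = - (c * ?z + s * ?j)" by (simp only: mult_minus_right minus_add_distrib)
    also have "\<dots> = t" unfolding e using False by simp
    finally have "c * (- ?z) + s * (- ?j) = t" .
    moreover have "(- ?j)\<^sup>2 + w \<le> shaved_profile h d (- ?z)"
      using le' by (simp only: power2_minus shaved_profile_minus)
    ultimately show ?thesis by blast
  qed
qed

text \<open>The dilation is made to cost the axial section slightly more than the ring does:
  \<open>2 * (1 - c ^ (k + 1)) = (1 + d) * E\<close>. The volume estimate then rests on
  \<open>k * (k + 2) < (k + 1)\<^sup>2\<close>, whose slack absorbs \<open>d\<close> and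
  \<open>h\<close>.\<close>

lemma choose_dilation:
  fixes E :: real
  assumes k: "k > 0" and E: "0 < E" "E \<le> 1" and h: "h > 0" and d: "0 < d"
    and hd: "(1 + d) * (1 + h) * (real k * (real k + 2)) < (1 - d) * (real k + 1)\<^sup>2"
    and d1: "d < 1"
  obtains c where "0 < c" "c < 1" "E < 2 * (1 - c ^ (k + 1))"
    "(1 - c ^ (k + 2)) * (2 * (1 + h)) < (1 - d) * (real (Suc k) / real k) * E"
proof -
  define e where "e = (1 + d) * E / 2"
  define c where "c = root (k + 1) (1 - e)"
  have "d * E \<le> d" "0 < d * E" using E d by auto
  moreover have "2 * e = E + d * E" by (simp add: e_def algebra_simps)
  ultimately have e: "0 < e" "e < 1" "E < 2 * e" using E d1 by linarith+
  have ck: "c ^ (k + 1) = 1 - e" using e unfolding c_def by (intro real_root_pow_pos2) auto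
  have c0: "c > 0" using e by (simp add: c_def)
  have c1: "c < 1"
  proof (rule ccontr)
    assume "\<not> c < 1"
    then have "1 \<le> c ^ (k + 1)" by (intro one_le_power) simp
    then show False using ck e by simp
  qed
  \<comment> \<open>Each term of the geometric sum is at least \<open>c ^ (k + 1)\<close>. This
    bounds \<open>(1 - c) * c ^ (k + 1)\<close>, the additional loss in one more dimension, by
    \<open>e / (k + 1)\<close>.\<close>
  have "(\<Sum>i<k + 1. c ^ (k + 1)) \<le> (\<Sum>i<k + 1. c ^ i)"
    using c0 c1 by (intro sum_mono power_decreasing) auto
  then have "real (k + 1) * c ^ (k + 1) \<le> (\<Sum>i<k + 1. c ^ i)"
    by (simp only: sum_constant card_lessThan)
  then have "(1 - c) * (real (k + 1) * c ^ (k + 1)) \<le> (1 - c) * (\<Sum>i<k + 1. c ^ i)"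
    using c1 by (intro mult_left_mono) auto
  also have "\<dots> = e" using one_diff_power_eq[of c "k + 1"] ck by simp
  finally have 1: "real (k + 1) * ((1 - c) * c ^ (k + 1)) \<le> e" by (simp add: mult_ac)
  have *: "1 - c ^ (k + 2) = e + (1 - c) * c ^ (k + 1)" using ck by (simp add: algebra_simps)
  have "real (k + 1) * (1 - c ^ (k + 2)) = real (k + 1) * e + real (k + 1) * ((1 - c) * c ^ (k + 1))"
    unfolding * by (rule distrib_left)
  moreover have "real (k + 2) * e = real (k + 1) * e + e" by (simp add: algebra_simps)
  ultimately have "real (k + 1) * (1 - c ^ (k + 2)) \<le> real (k + 2) * e" using 1 by linarith
  then have "(1 - c ^ (k + 2)) \<le> real (k + 2) * e / real (k + 1)"
    by (simp add: field_simps)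
  then have "(1 - c ^ (k + 2)) * (2 * (1 + h)) \<le> (real (k + 2) * e / real (k + 1)) * (2 * (1 + h))"
    using h by (intro mult_right_mono) auto
  also have "\<dots> = ((1 + d) * (1 + h) * (real k * (real k + 2))) * (E / (real k * (real k + 1)))"
  proof -
    have "a * (a + 2) * (E / (a * (a + 1))) = (a + 2) * E / (a + 1)" if "a > 0" for a :: real
      using that by simp
    from this[of "real k"]
    have *: "(1 + d) * (1 + h) * (real k * (real k + 2)) * (E / (real k * (real k + 1)))
        = (1 + d) * (1 + h) * ((real k + 2) * E / (real k + 1))"
      using k by (simp only: mult.assoc of_nat_0_less_iff)
    show ?thesis unfolding * by (simp add: e_def divide_simps) (simp add: algebra_simps)
  qed
  also have "\<dots> < ((1 - d) * (real k + 1)\<^sup>2) * (E / (real k * (real k + 1)))"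
    using hd E k by (intro mult_strict_right_mono) auto
  also have "\<dots> = (1 - d) * (real (Suc k) / real k) * E"
  proof -
    have "(a + 1)\<^sup>2 * (E / (a * (a + 1))) = (a + 1) / a * E" if "a > 0" for a :: real
      using that by (simp add: power2_eq_square)
    from this[of "real k"]
    have *: "(real k + 1)\<^sup>2 * (E / (real k * (real k + 1))) = (real k + 1) / real k * E"
      using k by (simp only: of_nat_0_less_iff)
    have "real (Suc k) = real k + 1" by simp
    then show ?thesis by (simp only: mult.assoc *)
  qed
  finally show ?thesis using that[of c] c0 c1 ck e by simp
qed

text \<open>One value serves for both \<open>h\<close> and \<open>d\<close>. With
  \<open>K = (k + 1)\<^sup>2\<close> the two sides differ by 1 at \<open>h = 0\<close>, and a small
  \<open>h\<close> perturbs this by about \<open>3 * h * K\<close>, which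
  \<open>h = 1 / (4 * K)\<close> keeps near 3/4.\<close>

lemma small_parameter:
  assumes "k \<ge> (1::nat)"
  obtains h :: real where "0 < h" "h \<le> 1 / 2"
    "(1 + h) * (1 + h) * (real k * (real k + 2)) < (1 - h) * (real k + 1)\<^sup>2"
proof -
  define K where "K = (real k + 1)\<^sup>2"
  define h where "h = 1 / (4 * K)"
  have K: "K \<ge> 1" "real k * (real k + 2) = K - 1"
    by (auto simp: K_def power2_eq_square algebra_simps)
  have hK: "h * K = 1 / 4" using K by (simp add: h_def)
  have h: "0 < h" "h \<le> 1 / 4" using K by (auto simp: h_def field_simps)
  have "(1 + h) * (1 + h) * (K - 1) = K + 2 * (h * K) + h * (h * K) - (1 + h) * (1 + h)"
    by (simp add: algebra_simps)
  also have "\<dots> = K + 1 / 2 + h / 4 - (1 + h) * (1 + h)" unfolding hK by simp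
  also have "\<dots> < K - 1 / 4"
    using h mult_mono[of 1 "1 + h" 1 "1 + h"] by linarith
  also have "\<dots> = (1 - h) * K" using hK by (simp add: algebra_simps)
  finally show ?thesis using that[of h] h K by (simp add: K_def)
qed

section \<open>Bodies of revolution\<close>

definition rev_body :: "'a::euclidean_space \<Rightarrow> (real \<Rightarrow> real) \<Rightarrow> 'a set" where
  "rev_body e A = {v. (norm (v - (v \<bullet> e) *\<^sub>R e))\<^sup>2 \<le> A (v \<bullet> e)}"

lemma rev_body_mono: "(\<And>x. A x \<le> A' x) \<Longrightarrow> rev_body e A \<subseteq> rev_body e A'"
  unfolding rev_body_def by (auto intro: order_trans)

lemma rev_body_axis:
  assumes "norm e = 1" "w \<bullet> e = 0"
  shows "x *\<^sub>R e + w \<in> rev_body e A \<longleftrightarrow> (norm w)\<^sup>2 \<le> A x"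
proof -
  have "(x *\<^sub>R e + w) \<bullet> e = x"
    using assms by (simp add: inner_add_left norm_eq_1)
  then show ?thesis by (simp add: rev_body_def)
qed

lemma closed_rev_body:
  assumes "continuous_on UNIV A"
  shows "closed (rev_body e A)"
  unfolding rev_body_def
  by (intro closed_Collect_le continuous_intros continuous_on_compose2[OF assms]) auto

lemma bounded_rev_body_cap:
  fixes e :: "'a::euclidean_space"
  assumes e: "norm e = 1" and h: "h > 0"
  shows "bounded (rev_body e (cap_profile h))"
  unfolding bounded_iff
proof (intro exI ballI)
  fix v assume v: "v \<in> rev_body e (cap_profile h)"
  let ?y = "v - (v \<bullet> e) *\<^sub>R e"
  have le: "(norm ?y)\<^sup>2 \<le> cap_profile h (v \<bullet> e)" using v by (simp add: rev_body_def)
  then have "(norm ?y)\<^sup>2 \<le> 1" using cap_profile_le_1 order_trans by blast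
  then have 1: "norm ?y \<le> 1" by (simp add: power_le_one_iff abs_square_le_1)
  have "0 \<le> cap_profile h (v \<bullet> e)" using le zero_le_power2 order_trans by blast
  then have "0 \<le> 1 - (\<bar>v \<bullet> e\<bar> - 1) / h" by (simp add: cap_profile_def)
  then have 2: "\<bar>v \<bullet> e\<bar> \<le> 1 + h" using h by (simp add: field_simps)
  have "norm v \<le> norm ?y + norm ((v \<bullet> e) *\<^sub>R e)"
    using norm_triangle_ineq[of ?y "(v \<bullet> e) *\<^sub>R e"] by simp
  also have "\<dots> \<le> 2 + h" using 1 2 e by simp
  finally show "norm v \<le> 2 + h" .
qed

lemma cball_le_rev_body_shaved:
  fixes e :: "'a::euclidean_space"
  assumes e: "norm e = 1" and h: "h > 0" "d < 2"
  shows "cball 0 1 \<subseteq> rev_body e (shaved_profile h d)"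
proof
  fix v :: 'a assume "v \<in> cball 0 1"
  then have v: "norm v \<le> 1" by simp
  have "\<bar>v \<bullet> e\<bar> \<le> 1" using Cauchy_Schwarz_ineq2[of v e] v e by simp
  moreover have "(norm (v - (v \<bullet> e) *\<^sub>R e))\<^sup>2 \<le> 1"
  proof -
    have "(norm (v - (v \<bullet> e) *\<^sub>R e))\<^sup>2 = (norm v)\<^sup>2 - (v \<bullet> e)\<^sup>2"
      using e unfolding power2_norm_eq_inner norm_eq_1
      by (simp add: inner_diff_left inner_diff_right inner_commute power2_eq_square)
    also have "\<dots> \<le> (norm v)\<^sup>2" by simp
    also have "\<dots> \<le> 1" using v by (simp add: power_le_one)
    finally show ?thesis .
  qed
  ultimately show "v \<in> rev_body e (shaved_profile h d)"
    using h by (simp add: rev_body_def shaved_profile_eq_1)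
qed

text \<open>Solved for the axial coordinate, the body becomes an intersection of sublevel sets of
  convex functions; this form serves the proof of convexity.\<close>

lemma rev_body_cap_eq:
  fixes e :: "'a::euclidean_space"
  assumes "h > 0"
  shows "rev_body e (cap_profile h) =
    {v. norm (v - (v \<bullet> e) *\<^sub>R e) \<le> 1 \<and> \<bar>v \<bullet> e\<bar> + h * (norm (v - (v \<bullet> e) *\<^sub>R e))\<^sup>2 \<le> 1 + h}"
proof -
  have "(norm y)\<^sup>2 \<le> cap_profile h x \<longleftrightarrow> norm y \<le> 1 \<and> \<bar>x\<bar> + h * (norm y)\<^sup>2 \<le> 1 + h" for y :: 'a and x
    using assms by (auto simp: cap_profile_def abs_square_le_1 field_simps)
  then show ?thesis by (simp add: rev_body_def)
qed

text \<open>Inside the uncut body the expression squared in \<open>shaved_profile\<close> is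
  nonnegative, so the square root can be taken and a convex condition remains.\<close>

lemma rev_body_shaved_eq:
  fixes e :: "'a::euclidean_space"
  assumes h: "h > 0" and d: "0 < d" "d < 1"
  shows "rev_body e (shaved_profile h d) = rev_body e (cap_profile h) \<inter>
    {v. \<bar>v \<bullet> e\<bar> + h * (2 - d) * norm (v - (v \<bullet> e) *\<^sub>R e) \<le> 1 + h * (2 - d)}"
proof -
  have "n\<^sup>2 \<le> shaved_profile h d x \<longleftrightarrow>
      n\<^sup>2 \<le> cap_profile h x \<and> \<bar>x\<bar> + h * (2 - d) * n \<le> 1 + h * (2 - d)" if n: "n \<ge> 0" for n x
  proof (cases "n\<^sup>2 \<le> cap_profile h x")
    case True
    then have "0 \<le> cap_profile h x" using zero_le_power2 order_trans by blast
    then have "(\<bar>x\<bar> - 1) / h \<le> 1" by (simp add: cap_profile_def)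
    then have le: "\<bar>x\<bar> - 1 \<le> h" using h by simp
    let ?l = "1 - (\<bar>x\<bar> - 1) / (h * (2 - d))"
    have "h \<le> h * (2 - d)" using h d mult_left_mono[of 1 "2 - d" h] by simp
    then have "\<bar>x\<bar> - 1 \<le> h * (2 - d)" using le by linarith
    then have "?l \<ge> 0" using h d by simp
    then have "n\<^sup>2 \<le> ?l\<^sup>2 \<longleftrightarrow> n \<le> ?l" using n by (simp add: abs_le_square_iff[symmetric])
    also have "\<dots> \<longleftrightarrow> \<bar>x\<bar> + h * (2 - d) * n \<le> 1 + h * (2 - d)"
      using h d by (auto simp: field_simps)
    finally show ?thesis using True by (simp add: shaved_profile_def)
  next
    case False
    then show ?thesis by (simp add: shaved_profile_def)
  qed
  then show ?thesis by (auto simp: rev_body_def)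
qed

section \<open>Convexity of the two bodies\<close>

lemma convex_sublevel:
  assumes "convex_on UNIV f"
  shows "convex {x. f x \<le> (c::real)}"
proof (rule convexI)
  fix x y u v assume *: "x \<in> {x. f x \<le> c}" "y \<in> {x. f x \<le> c}" and uv: "0 \<le> u" "0 \<le> v" "u + v = (1::real)"
  have "f (u *\<^sub>R x + v *\<^sub>R y) \<le> u * f x + v * f y"
    using assms uv by (simp add: convex_on_def)
  also have "\<dots> \<le> u * c + v * c" using * uv by (intro add_mono mult_left_mono) auto
  also have "\<dots> = c" using uv by (metis distrib_right mult_1)
  finally show "u *\<^sub>R x + v *\<^sub>R y \<in> {x. f x \<le> c}" by simp
qed

lemma convex_on_norm_linear:
  assumes "linear f"
  shows "convex_on UNIV (\<lambda>x. norm (f x))"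
proof (rule convex_onI)
  fix t :: real and x y assume t: "0 < t" "t < 1"
  have "norm (f ((1 - t) *\<^sub>R x + t *\<^sub>R y)) = norm ((1 - t) *\<^sub>R f x + t *\<^sub>R f y)"
    using assms by (simp add: linear_add linear_scale)
  also have "\<dots> \<le> norm ((1 - t) *\<^sub>R f x) + norm (t *\<^sub>R f y)" by (rule norm_triangle_ineq)
  finally show "norm (f ((1 - t) *\<^sub>R x + t *\<^sub>R y)) \<le> (1 - t) * norm (f x) + t * norm (f y)"
    using t by simp
qed simp

lemma linear_axis_components:
  fixes e :: "'a::euclidean_space"
  shows "linear (\<lambda>v. v - (v \<bullet> e) *\<^sub>R e)" "linear (\<lambda>v. v \<bullet> e)"
  by (auto intro!: linearI simp: inner_add_left algebra_simps)

lemma convex_rev_body_cap: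
  fixes e :: "'a::euclidean_space"
  assumes h: "h > 0"
  shows "convex (rev_body e (cap_profile h))"
proof -
  let ?y = "\<lambda>v::'a. norm (v - (v \<bullet> e) *\<^sub>R e)"
  have y: "convex_on UNIV ?y" by (intro convex_on_norm_linear linear_axis_components)
  have x: "convex_on UNIV (\<lambda>v. \<bar>v \<bullet> e\<bar>)"
    using convex_on_norm_linear[OF linear_axis_components(2), of e] by simp
  have y2: "convex_on UNIV (\<lambda>v. (?y v)\<^sup>2)"
  proof (rule convex_onI)
    fix t :: real and u v :: 'a assume t: "0 < t" "t < 1"
    have "?y ((1 - t) *\<^sub>R u + t *\<^sub>R v) \<le> (1 - t) * ?y u + t * ?y v"
      using y t by (intro convex_onD[OF y]) auto
    then have "(?y ((1 - t) *\<^sub>R u + t *\<^sub>R v))\<^sup>2 \<le> ((1 - t) * ?y u + t * ?y v)\<^sup>2"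
      by (intro power_mono) auto
    also have "\<dots> \<le> (1 - t) * (?y u)\<^sup>2 + t * (?y v)\<^sup>2"
    proof -
      have "(1 - t) * (?y u)\<^sup>2 + t * (?y v)\<^sup>2 - ((1 - t) * ?y u + t * ?y v)\<^sup>2
          = t * (1 - t) * (?y u - ?y v)\<^sup>2"
        by (simp add: power2_eq_square algebra_simps)
      moreover have "\<dots> \<ge> 0" using t by simp
      ultimately show ?thesis by linarith
    qed
    finally show "(?y ((1 - t) *\<^sub>R u + t *\<^sub>R v))\<^sup>2 \<le> (1 - t) * (?y u)\<^sup>2 + t * (?y v)\<^sup>2" .
  qed simp
  have "rev_body e (cap_profile h) = {v. ?y v \<le> 1} \<inter> {v. \<bar>v \<bullet> e\<bar> + h * (?y v)\<^sup>2 \<le> 1 + h}"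
    using rev_body_cap_eq[OF h, of e] by auto
  then show ?thesis
    using h by (auto intro!: convex_Int convex_sublevel convex_on_add convex_on_cmul x y y2)
qed

lemma convex_rev_body_shaved:
  fixes e :: "'a::euclidean_space"
  assumes h: "h > 0" and d: "0 < d" "d < 1"
  shows "convex (rev_body e (shaved_profile h d))"
proof -
  let ?y = "\<lambda>v::'a. norm (v - (v \<bullet> e) *\<^sub>R e)"
  have y: "convex_on UNIV ?y" by (intro convex_on_norm_linear linear_axis_components)
  have x: "convex_on UNIV (\<lambda>v. \<bar>v \<bullet> e\<bar>)"
    using convex_on_norm_linear[OF linear_axis_components(2), of e] by simp
  show ?thesis
    unfolding rev_body_shaved_eq[OF assms]
    using h d by (intro convex_Int convex_sublevel convex_on_add convex_on_cmul x y convex_rev_body_cap) auto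
qed

section \<open>Symmetry, rotational invariance and dilation of bodies\<close>

lemma origin_symmetricI: "(\<And>v. v \<in> K \<Longrightarrow> - v \<in> K) \<Longrightarrow> origin_symmetric K"
  unfolding origin_symmetric_def by (auto simp: image_iff) (metis minus_minus)

lemma origin_symmetric_rev_body:
  assumes "\<And>x. A (- x) = A x"
  shows "origin_symmetric (rev_body e A)"
proof (rule origin_symmetricI)
  fix v assume "v \<in> rev_body e A"
  moreover have "norm (- v - (- v \<bullet> e) *\<^sub>R e) = norm (v - (v \<bullet> e) *\<^sub>R e)"
    by (metis (no_types, lifting) inner_minus_left minus_diff_eq norm_minus_commute
        scaleR_minus_left uminus_add_conv_diff diff_minus_eq_add)
  ultimately show "- v \<in> rev_body e A" by (simp add: rev_body_def assms)
qed

lemma body_of_revolution_rev_body: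
  fixes e :: "'a::euclidean_space"
  assumes "e \<noteq> 0"
  shows "body_of_revolution (rev_body e A)"
  unfolding body_of_revolution_def
proof (intro exI[of _ e] conjI allI impI assms)
  fix T :: "'a \<Rightarrow> 'a" assume "orthogonal_transformation T \<and> (\<forall>x\<in>span {e}. T x = x)"
  then have T: "orthogonal_transformation T" and Te: "T e = e" by (auto simp: span_base)
  have lin: "linear T" using T by (rule orthogonal_transformation_linear)
  have iff: "T v \<in> rev_body e A \<longleftrightarrow> v \<in> rev_body e A" for v
  proof -
    have x: "T v \<bullet> e = v \<bullet> e" using T Te unfolding orthogonal_transformation_def by metis
    have "T v - (T v \<bullet> e) *\<^sub>R e = T (v - (v \<bullet> e) *\<^sub>R e)"
      using lin Te x by (simp add: linear_diff linear_scale)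
    then have "norm (T v - (T v \<bullet> e) *\<^sub>R e) = norm (v - (v \<bullet> e) *\<^sub>R e)"
      using orthogonal_transformation_norm[OF T] by simp
    then show ?thesis by (simp add: rev_body_def x)
  qed
  show "T ` rev_body e A = rev_body e A"
    using iff orthogonal_transformation_surj[OF T] by (auto simp: image_iff) (metis surjD)
qed

lemma body_of_revolution_scale:
  fixes K :: "'a::euclidean_space set"
  assumes "body_of_revolution K"
  shows "body_of_revolution ((*\<^sub>R) c ` K)"
proof -
  obtain u where u: "u \<noteq> 0"
    "\<And>T. orthogonal_transformation T \<and> (\<forall>x\<in>span {u}. T x = x) \<Longrightarrow> T ` K = K"
    using assms unfolding body_of_revolution_def by blast
  show ?thesis
    unfolding body_of_revolution_def
  proof (intro exI[of _ u] conjI allI impI u)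
    fix T :: "'a \<Rightarrow> 'a" assume T: "orthogonal_transformation T \<and> (\<forall>x\<in>span {u}. T x = x)"
    then have "linear T" by (simp add: orthogonal_transformation_linear)
    then have "T ` (*\<^sub>R) c ` K = (*\<^sub>R) c ` T ` K"
      by (simp add: image_image linear_scale)
    then show "T ` (*\<^sub>R) c ` K = (*\<^sub>R) c ` K" using u(2)[OF T] by simp
  qed
qed

lemma origin_symmetric_scale:
  "origin_symmetric K \<Longrightarrow> origin_symmetric ((*\<^sub>R) c ` K)"
  unfolding origin_symmetric_def by (metis (no_types, lifting) image_cong image_image scaleR_minus_right)

lemma convex_body_scale:
  fixes K :: "'a::euclidean_space set"
  assumes "convex_body K" "c \<noteq> 0"
  shows "convex_body ((*\<^sub>R) c ` K)"
proof -
  have "interior ((*\<^sub>R) c ` K) = (*\<^sub>R) c ` interior K"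
    using assms(2) by (intro interior_injective_linear_image linear_scaleR) (auto simp: inj_def)
  then show ?thesis
    using assms(1) unfolding convex_body_def by (simp add: compact_scaling convex_scaling)
qed

lemma convex_body_rev_body:
  fixes e :: "'a::euclidean_space"
  assumes e: "norm e = 1" and h: "h > 0" and d: "0 < d" "d < 1"
  shows "convex_body (rev_body e (cap_profile h))" "convex_body (rev_body e (shaved_profile h d))"
proof -
  have sub: "rev_body e (shaved_profile h d) \<subseteq> rev_body e (cap_profile h)"
    by (intro rev_body_mono shaved_le_cap_profile)
  have "ball 0 1 \<subseteq> rev_body e (shaved_profile h d)"
    using cball_le_rev_body_shaved[OF e h, of d] d by auto
  then have int: "0 \<in> interior (rev_body e (shaved_profile h d))"
    by (meson centre_in_ball interior_maximal open_ball subsetD zero_less_one)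
  show "convex_body (rev_body e (cap_profile h))"
    using int interior_mono[OF sub] bounded_rev_body_cap[OF e h]
      closed_rev_body[OF continuous_on_cap_profile, of e h] convex_rev_body_cap[OF h, of e]
    unfolding convex_body_def compact_eq_bounded_closed by blast
  show "convex_body (rev_body e (shaved_profile h d))"
    using int bounded_subset[OF bounded_rev_body_cap[OF e h] sub]
      closed_rev_body[OF continuous_on_shaved_profile, of e h d] convex_rev_body_shaved[OF h d, of e]
    unfolding convex_body_def compact_eq_bounded_closed by blast
qed

section \<open>Hyperplanes oblique to the axis\<close>

text \<open>Only \<open>w \<in> S\<close> has to be tested, since \<open>coord_lborel B\<close> is
  carried by \<open>S\<close>; a negative \<open>\<phi> t\<close> stands for an empty slice.\<close>

lemma emeasure_coord_lborel_round_slices: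
  fixes S :: "'a::euclidean_space set"
  assumes B: "orthonormal_basis_of S B" "card B > 0" "f \<notin> B" and A: "A \<in> sets borel"
    and slice: "\<And>t w. w \<in> S \<Longrightarrow> t *\<^sub>R f + w \<in> A \<longleftrightarrow> (norm w)\<^sup>2 \<le> \<phi> t"
  shows "emeasure (coord_lborel (insert f B)) A
    = (\<integral>\<^sup>+t. ennreal (unit_ball_vol (card B) * ball_radius_pow (card B) (\<phi> t)) \<partial>lborel)"
proof -
  have span: "span B = S" using B by (simp add: orthonormal_basis_of_def)
  have "emeasure (coord_lborel B) ((\<lambda>w. t *\<^sub>R f + w) -` A)
      = emeasure (coord_lborel B) {w. (norm w)\<^sup>2 \<le> \<phi> t}" for t
  proof -
    have m: "(\<lambda>w. t *\<^sub>R f + w) -` A \<in> sets borel"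
      using measurable_sets[OF _ A, of "\<lambda>w. t *\<^sub>R f + w" borel] by simp
    have "{w::'a. (norm w)\<^sup>2 \<le> \<phi> t} \<in> sets borel" by measurable
    then show ?thesis
      using slice[of _ t] m unfolding span[symmetric]
      by (intro antisym emeasure_coord_lborel_mono) auto
  qed
  then show ?thesis
    using orthonormal_basis_of_finite[OF B(1)]
    by (simp add: emeasure_coord_lborel_insert B A emeasure_coord_lborel_sqball[OF B(1,2)])
qed

lemma orthonormal_basis_of_insert:
  fixes S T :: "'a::euclidean_space set"
  assumes B: "orthonormal_basis_of S B" and "subspace T" "S \<subseteq> T"
    and f: "norm f = 1" "f \<in> T" "\<And>w. w \<in> S \<Longrightarrow> w \<bullet> f = 0"
    and split: "\<And>v. v \<in> T \<Longrightarrow> v - (v \<bullet> f) *\<^sub>R f \<in> S"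
  shows "orthonormal_basis_of T (insert f B)" "f \<notin> B"
proof -
  have span: "span B = S" and BS: "B \<subseteq> S"
    using B span_superset by (auto simp: orthonormal_basis_of_def)
  show "f \<notin> B"
  proof
    assume "f \<in> B"
    then have "f \<bullet> f = 0" using f(3) BS by blast
    then show False using f(1) by simp
  qed
  have "span (insert f B) = T"
  proof
    show "span (insert f B) \<subseteq> T" using assms(2,3) BS f(2) by (intro span_minimal) auto
    show "T \<subseteq> span (insert f B)"
    proof
      fix v assume "v \<in> T"
      then have "v - (v \<bullet> f) *\<^sub>R f \<in> span (insert f B)"
        using split span span_mono[of B "insert f B"] by auto
      moreover have "(v \<bullet> f) *\<^sub>R f \<in> span (insert f B)" by (intro span_scale span_base) simp
      ultimately have "(v - (v \<bullet> f) *\<^sub>R f) + (v \<bullet> f) *\<^sub>R f \<in> span (insert f B)" by (rule span_add)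
      then show "v \<in> span (insert f B)" by simp
    qed
  qed
  then show "orthonormal_basis_of T (insert f B)"
    using B f BS unfolding orthonormal_basis_of_def
    by (auto simp: pairwise_insert orthogonal_def inner_commute)
qed

lemma orthogonal_comp_singleton: "v \<in> {a}\<^sup>\<bottom> \<longleftrightarrow> v \<bullet> a = 0"
  by (simp add: orthogonal_comp_def orthogonal_def inner_commute)

lemma card_orthonormal_basis_of_hyperplane:
  fixes a :: "'a::euclidean_space"
  assumes "orthonormal_basis_of ({a}\<^sup>\<bottom>) B" "a \<noteq> 0"
  shows "card B = DIM('a) - 1"
proof -
  have ind: "independent B"
    using assms by (intro pairwise_orthogonal_independent) (auto simp: orthonormal_basis_of_def)
  have "{a}\<^sup>\<bottom> = {x. a \<bullet> x = 0}" by (auto simp: orthogonal_comp_singleton inner_commute)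
  moreover have "card B = dim ({a}\<^sup>\<bottom>)"
    using dim_span_eq_card_independent[OF ind] assms(1) unfolding orthonormal_basis_of_def by metis
  ultimately show ?thesis using dim_hyperplane[OF assms(2)] by simp
qed

lemma measure_scale_subspace:
  fixes A :: "'a::euclidean_space set"
  assumes "finite B" "c > 0" "A \<in> sets borel"
  shows "measure (coord_lborel B) ((*\<^sub>R) c ` A) = c ^ card B * measure (coord_lborel B) A"
  using assms by (simp add: measure_def emeasure_coord_lborel_scale enn2real_mult)

text \<open>Coordinates for a hyperplane that is not orthogonal to the axis \<open>e\<close>. The
  vectors \<open>e\<close>, \<open>g\<close> span the plane of axis and normal,
  \<open>c *\<^sub>R e + s *\<^sub>R g\<close> is the direction of the hyperplane closest to the
  axis, \<open>s / c\<close> is the slope over the axis, and \<open>B\<close> spans the part of the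
  hyperplane orthogonal to the axis. Both signs of \<open>\<xi>\<close> describe the same
  hyperplane.\<close>

locale tilted_hyperplane =
  fixes e g \<xi> :: "'a::euclidean_space" and c s :: real and B :: "'a set"
  assumes e: "norm e = 1" and g: "norm g = 1" and eg: "e \<bullet> g = 0"
    and c: "c > 0" and s: "s \<ge> 0" and cs: "c\<^sup>2 + s\<^sup>2 = 1"
    and \<xi>: "\<xi> = s *\<^sub>R e - c *\<^sub>R g \<or> \<xi> = c *\<^sub>R g - s *\<^sub>R e"
    and B: "orthonormal_basis_of ({e, g}\<^sup>\<bottom>) B"
begin

definition f where "f = c *\<^sub>R e + s *\<^sub>R g"

lemma ee: "e \<bullet> e = 1" and gg: "g \<bullet> g = 1" and ge: "g \<bullet> e = 0"
  using e g eg by (auto simp: norm_eq_1 inner_commute)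

lemma mem_comp: "w \<in> {e, g}\<^sup>\<bottom> \<longleftrightarrow> w \<bullet> e = 0 \<and> w \<bullet> g = 0"
  by (auto simp: orthogonal_comp_def orthogonal_def inner_commute)

lemma mem_hyperplane: "v \<in> {\<xi>}\<^sup>\<bottom> \<longleftrightarrow> s * (v \<bullet> e) = c * (v \<bullet> g)"
  using \<xi> by (auto simp: orthogonal_comp_singleton inner_diff_right)

lemma cs': "c * c + s * s = 1"
  using cs by (simp add: power2_eq_square)

lemma basis: "orthonormal_basis_of ({\<xi>}\<^sup>\<bottom>) (insert f B)" "f \<notin> B"
proof -
  have 1: "subspace ({\<xi>}\<^sup>\<bottom>)" by (rule subspace_orthogonal_comp)
  have 2: "{e, g}\<^sup>\<bottom> \<subseteq> {\<xi>}\<^sup>\<bottom>" by (auto simp: mem_comp mem_hyperplane)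
  have fe: "f \<bullet> e = c" "f \<bullet> g = s"
    by (auto simp: f_def inner_add_left ee gg ge eg)
  have "f \<bullet> f = c * (f \<bullet> e) + s * (f \<bullet> g)"
    by (subst (2) f_def) (simp add: inner_add_right)
  then have 3: "norm f = 1" using cs' by (simp add: norm_eq_1 fe)
  have 4: "f \<in> {\<xi>}\<^sup>\<bottom>" by (simp add: mem_hyperplane fe)
  have 5: "w \<bullet> f = 0" if "w \<in> {e, g}\<^sup>\<bottom>" for w
    using that by (simp add: mem_comp f_def inner_add_right)
  have 6: "v - (v \<bullet> f) *\<^sub>R f \<in> {e, g}\<^sup>\<bottom>" if "v \<in> {\<xi>}\<^sup>\<bottom>" for v
  proof -
    have h: "s * (v \<bullet> e) = c * (v \<bullet> g)" using that by (simp add: mem_hyperplane)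
    have vf: "v \<bullet> f = c * (v \<bullet> e) + s * (v \<bullet> g)" by (simp add: f_def inner_add_right)
    have "(v \<bullet> f) * c = v \<bullet> e" "(v \<bullet> f) * s = v \<bullet> g"
      unfolding vf using h cs' by algebra+
    then show ?thesis by (simp add: mem_comp inner_diff_left fe)
  qed
  show "orthonormal_basis_of ({\<xi>}\<^sup>\<bottom>) (insert f B)" "f \<notin> B"
    using orthonormal_basis_of_insert[OF B 1 2 3 4 5 6] by auto
qed

lemma finB: "finite B"
  using B by (rule orthonormal_basis_of_finite)

lemma axis_coordinates:
  assumes "w \<in> {e, g}\<^sup>\<bottom>"
  shows "x *\<^sub>R e + y *\<^sub>R g + w \<in> rev_body e A \<longleftrightarrow> y\<^sup>2 + (norm w)\<^sup>2 \<le> A x"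
proof -
  have "(norm (y *\<^sub>R g + w))\<^sup>2 = y\<^sup>2 + (norm w)\<^sup>2"
    using assms gg unfolding power2_norm_eq_inner mem_comp
    by (simp add: inner_add_left inner_add_right inner_commute power2_eq_square)
  moreover have "(y *\<^sub>R g + w) \<bullet> e = 0"
    using assms by (simp add: mem_comp inner_add_left ge)
  ultimately show ?thesis
    using rev_body_axis[OF e, of "y *\<^sub>R g + w" x A] by (simp add: add.assoc)
qed

lemma f_coordinates: "t *\<^sub>R f + w = (t * c) *\<^sub>R e + (t * s) *\<^sub>R g + w"
  by (simp add: f_def scaleR_add_right)

text \<open>The slice at \<open>t *\<^sub>R f\<close> has axial coordinate \<open>t * c\<close> and
  is displaced from the axis by \<open>t * s\<close>, whence the lowered squared radius.\<close>

lemma emeasure_section: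
  assumes A: "continuous_on UNIV A" and k: "card B > 0"
  shows "emeasure (coord_lborel (insert f B)) (rev_body e A \<inter> {\<xi>}\<^sup>\<bottom>)
    = (\<integral>\<^sup>+t. ennreal (unit_ball_vol (card B) * ball_radius_pow (card B) (A (t * c) - (t * s)\<^sup>2)) \<partial>lborel)"
proof (rule emeasure_coord_lborel_round_slices[OF B k basis(2)])
  show "rev_body e A \<inter> {\<xi>}\<^sup>\<bottom> \<in> sets borel"
    by (intro sets.Int borel_closed closed_rev_body[OF A] closed_subspace subspace_orthogonal_comp)
  fix t w assume w: "w \<in> {e, g}\<^sup>\<bottom>"
  have "t *\<^sub>R f + w \<in> {\<xi>}\<^sup>\<bottom>"
    using w by (simp add: mem_hyperplane f_coordinates inner_add_left ee gg ge eg mem_comp)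
  then show "t *\<^sub>R f + w \<in> rev_body e A \<inter> {\<xi>}\<^sup>\<bottom> \<longleftrightarrow> (norm w)\<^sup>2 \<le> A (t * c) - (t * s)\<^sup>2"
    using axis_coordinates[OF w, of "t * c" "t * s" A] by (auto simp: f_coordinates)
qed

text \<open>Projection along \<open>\<xi>\<close> collapses each line
  \<open>c * x + s * y = t\<close> in the plane of \<open>e\<close> and \<open>g\<close> to a point
  and leaves the component orthogonal to that plane unchanged.\<close>

lemma mem_shadow:
  assumes w: "w \<in> {e, g}\<^sup>\<bottom>"
  shows "t *\<^sub>R f + w \<in> orthogonal_projection ({\<xi>}\<^sup>\<bottom>) (rev_body e A)
    \<longleftrightarrow> (\<exists>x y. c * x + s * y = t \<and> y\<^sup>2 + (norm w)\<^sup>2 \<le> A x)"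
proof -
  have "norm \<xi> = 1"
    using \<xi> cs' by (auto simp: norm_eq_1 inner_diff_left inner_diff_right ee gg ge eg)
  note proj = orthogonal_projection_hyperplane[OF this]
  have step: "v - (v \<bullet> \<xi>) *\<^sub>R \<xi> = (c * x + s * y) *\<^sub>R f + u"
    if v: "v = x *\<^sub>R e + y *\<^sub>R g + u" and u: "u \<in> {e, g}\<^sup>\<bottom>" for v x y u
  proof -
    \<comment> \<open>The projection is even in \<open>\<xi>\<close>, so both signs reduce to
      \<open>p\<close>.\<close>
    define p where "p = s *\<^sub>R e - c *\<^sub>R g"
    have "\<xi> = p \<or> \<xi> = - p" using \<xi> by (auto simp: p_def)
    then have "(v \<bullet> \<xi>) *\<^sub>R \<xi> = (v \<bullet> p) *\<^sub>R p" by auto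
    moreover have "v \<bullet> p = s * x - c * y"
      using u by (simp add: v p_def inner_add_left inner_diff_right ee gg ge eg mem_comp)
    ultimately have "(v \<bullet> \<xi>) *\<^sub>R \<xi> = (s * x - c * y) *\<^sub>R (s *\<^sub>R e - c *\<^sub>R g)"
      by (simp only: p_def)
    moreover have "x - (s * x - c * y) * s = (c * x + s * y) * c"
      "y + (s * x - c * y) * c = (c * x + s * y) * s"
      using cs' by algebra+
    then have "x *\<^sub>R e = ((c * x + s * y) * c) *\<^sub>R e + ((s * x - c * y) * s) *\<^sub>R e"
      "y *\<^sub>R g = ((c * x + s * y) * s) *\<^sub>R g - ((s * x - c * y) * c) *\<^sub>R g"
      by (auto simp flip: scaleR_add_left scaleR_diff_left)
    ultimately show ?thesis
      unfolding v f_def by (simp add: scaleR_diff_right scaleR_add_right)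
  qed
  show ?thesis
  proof
    assume "t *\<^sub>R f + w \<in> orthogonal_projection ({\<xi>}\<^sup>\<bottom>) (rev_body e A)"
    then obtain v where v: "v \<in> rev_body e A" "t *\<^sub>R f + w = v - (v \<bullet> \<xi>) *\<^sub>R \<xi>"
      unfolding proj by auto
    define u where "u = v - (v \<bullet> e) *\<^sub>R e - (v \<bullet> g) *\<^sub>R g"
    have vu: "v = (v \<bullet> e) *\<^sub>R e + (v \<bullet> g) *\<^sub>R g + u" by (simp add: u_def)
    have u: "u \<in> {e, g}\<^sup>\<bottom>" by (simp add: mem_comp u_def inner_diff_left ee gg ge eg)
    have eq: "t *\<^sub>R f + w = (c * (v \<bullet> e) + s * (v \<bullet> g)) *\<^sub>R f + u"
      using step[OF vu u] v(2) by simp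
    have orth: "w \<bullet> f = 0" "u \<bullet> f = 0" using w u by (auto simp: mem_comp f_def inner_add_right)
    have ff: "f \<bullet> f = 1" using basis(1) by (simp add: orthonormal_basis_of_def norm_eq_1)
    from arg_cong[OF eq, of "\<lambda>z. z \<bullet> f"] have t: "t = c * (v \<bullet> e) + s * (v \<bullet> g)"
      by (simp add: inner_add_left orth ff)
    then have "w = u" using eq by simp
    moreover have "(v \<bullet> g)\<^sup>2 + (norm u)\<^sup>2 \<le> A (v \<bullet> e)"
      using v(1) vu axis_coordinates[OF u] by metis
    ultimately show "\<exists>x y. c * x + s * y = t \<and> y\<^sup>2 + (norm w)\<^sup>2 \<le> A x"
      using t by blast
  next
    assume "\<exists>x y. c * x + s * y = t \<and> y\<^sup>2 + (norm w)\<^sup>2 \<le> A x"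
    then obtain x y where xy: "c * x + s * y = t" "y\<^sup>2 + (norm w)\<^sup>2 \<le> A x" by blast
    then have "x *\<^sub>R e + y *\<^sub>R g + w \<in> rev_body e A" using axis_coordinates[OF w] by simp
    then show "t *\<^sub>R f + w \<in> orthogonal_projection ({\<xi>}\<^sup>\<bottom>) (rev_body e A)"
      unfolding proj using step[OF refl w, of x y] xy(1)
      by (intro image_eqI[of _ _ "x *\<^sub>R e + y *\<^sub>R g + w"]) (simp_all only:)
  qed
qed

end

lemma tilted_hyperplane_exists:
  fixes e \<xi> :: "'a::euclidean_space"
  assumes e: "norm e = 1" and \<xi>: "norm \<xi> = 1" "\<xi> \<noteq> e" "\<xi> \<noteq> - e"
  obtains g c s B where "tilted_hyperplane e g \<xi> c s B"
proof -
  define a where "a = \<xi> \<bullet> e"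
  define r where "r = \<xi> - a *\<^sub>R e"
  define c where "c = norm r"
  have ee: "e \<bullet> e = 1" using e by (simp add: norm_eq_1)
  have re: "r \<bullet> e = 0" by (simp add: r_def a_def inner_diff_left ee)
  have "c\<^sup>2 = 1 - a\<^sup>2"
    using \<xi>(1) unfolding c_def power2_norm_eq_inner r_def
    by (simp add: inner_diff_left inner_diff_right ee norm_eq_1 inner_commute a_def power2_eq_square)
  then have cs: "c\<^sup>2 + \<bar>a\<bar>\<^sup>2 = 1" by simp
  have "r \<noteq> 0"
  proof
    assume "r = 0"
    then have "\<xi> = a *\<^sub>R e" by (simp add: r_def)
    moreover from this have "\<bar>a\<bar> = 1" using e \<xi>(1) by simp
    then have "a = 1 \<or> a = -1" by linarith
    ultimately show False using \<xi> by auto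
  qed
  then have c: "c > 0" by (simp add: c_def)
  \<comment> \<open>The sign of \<open>g\<close> follows that of \<open>a\<close>, so that
    \<open>\<bar>a\<bar>\<close> can act as \<open>s\<close> in one of the two admissible forms of
    \<open>\<xi>\<close>.\<close>
  define g where "g = (if a \<ge> 0 then - (r /\<^sub>R c) else r /\<^sub>R c)"
  have "\<xi> = a *\<^sub>R e + r" by (simp add: r_def)
  moreover have "r = c *\<^sub>R (r /\<^sub>R c)" using c by simp
  ultimately have x: "\<xi> = \<bar>a\<bar> *\<^sub>R e - c *\<^sub>R g \<or> \<xi> = c *\<^sub>R g - \<bar>a\<bar> *\<^sub>R e"
    by (cases "a \<ge> 0") (auto simp: g_def)
  obtain B where "orthonormal_basis_of ({e, g}\<^sup>\<bottom>) B"
    using orthonormal_basis_of_exists[OF subspace_orthogonal_comp] by blast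
  moreover have "norm g = 1" using c by (simp add: g_def c_def)
  moreover have "e \<bullet> g = 0" using re by (simp add: g_def inner_commute)
  ultimately have "tilted_hyperplane e g \<xi> c \<bar>a\<bar> B"
    using e c cs x by unfold_locales auto
  then show ?thesis by (rule that)
qed

section \<open>Comparison of sections and shadows\<close>

text \<open>Here \<open>x\<close> and \<open>y\<close> are the measures for the uncut and the shaved
  body, \<open>m\<close> is the factor of the dilation, and \<open>q\<close> is a weight of the
  direction: the ring costs at most \<open>E * q\<close>, the dilation at least
  \<open>2 * (1 - m) * q\<close>. For \<open>q = 0\<close> the ring costs nothing and
  \<open>x > 0\<close> gives strictness.\<close>

lemma dilated_less:
  fixes x y E q m :: real
  assumes "x \<le> y + E * q" "2 * q \<le> x" "x > 0" "q \<ge> 0" "E < 2 * (1 - m)" "m < 1"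
  shows "m * x < y"
proof (cases "q = 0")
  case True
  have "m * x < 1 * x" using assms by (intro mult_strict_right_mono) auto
  then show ?thesis using assms(1) True by simp
next
  case False
  then have "E * q < 2 * (1 - m) * q" using assms by (intro mult_strict_right_mono) auto
  also have "\<dots> = (1 - m) * (2 * q)" by simp
  also have "\<dots> \<le> (1 - m) * x" using assms by (intro mult_left_mono) auto
  finally show ?thesis using assms(1) by (simp add: algebra_simps)
qed

lemma nn_integral_scale_arg:
  fixes F :: "real \<Rightarrow> ennreal"
  assumes "F \<in> borel_measurable borel" "c > 0"
  shows "(\<integral>\<^sup>+t. F (t * c) \<partial>lborel) = ennreal (1 / c) * (\<integral>\<^sup>+x. F x \<partial>lborel)"
proof -
  have "(\<integral>\<^sup>+x. F x \<partial>lborel) = ennreal c * (\<integral>\<^sup>+t. F (t * c) \<partial>lborel)"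
    using assms by (subst nn_integral_real_affine[where c = c and t = 0]) (auto simp: mult.commute)
  then have "ennreal (1 / c) * (\<integral>\<^sup>+x. F x \<partial>lborel)
      = ennreal (1 / c * c) * (\<integral>\<^sup>+t. F (t * c) \<partial>lborel)"
    using assms(2) by (subst ennreal_mult) (auto simp: mult.assoc)
  then show ?thesis using assms(2) by simp
qed

lemma emeasure_coord_lborel_eq_measure:
  fixes S :: "'a::euclidean_space set"
  assumes "orthonormal_basis_of S B" "bounded A" "A \<in> sets borel"
  shows "emeasure (coord_lborel B) A = ennreal (measure (coord_lborel B) A)"
  using emeasure_coord_lborel_bounded[OF assms] by (intro emeasure_eq_ennreal_measure) auto

lemma compact_orthogonal_projection_hyperplane:
  fixes K :: "'a::euclidean_space set"
  assumes "norm \<xi> = 1" "compact K"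
  shows "compact (orthogonal_projection ({\<xi>}\<^sup>\<bottom>) K)"
  unfolding orthogonal_projection_hyperplane[OF assms(1)]
  using assms(2) by (intro compact_continuous_image continuous_intros)

context tilted_hyperplane
begin

lemma norm_\<xi>: "norm \<xi> = 1"
  using \<xi> cs' by (auto simp: norm_eq_1 inner_diff_left inner_diff_right ee gg ge eg)

text \<open>Let \<open>q\<close> be the squared slope capped at 1,
  \<open>v = unit_ball_vol (card B)\<close> and \<open>r = sqrt (1 - q) ^ (card B - 2)\<close>. The
  ring costs at most \<open>v * r * E / c\<close>, whereas the part over the cylinder already
  contributes \<open>2 * v * r / c\<close>, so \<open>v * r / c\<close> is the weight of the
  direction.\<close>

lemma section_less:
  assumes h: "h > 0" and d: "0 < d" "d < 1" and k: "card B \<ge> 3"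
    and E: "(\<integral>\<^sup>+x. ennreal (profile_gap (card B) h d x) \<partial>lborel) = ennreal E" "E \<ge> 0"
    and m: "E < 2 * (1 - m)" "m < 1"
  shows "m * measure (coord_lborel (insert f B)) (rev_body e (cap_profile h) \<inter> {\<xi>}\<^sup>\<bottom>)
    < measure (coord_lborel (insert f B)) (rev_body e (shaved_profile h d) \<inter> {\<xi>}\<^sup>\<bottom>)"
proof -
  let ?k = "card B" and ?v = "unit_ball_vol (card B)"
  let ?M = "rev_body e (cap_profile h) \<inter> {\<xi>}\<^sup>\<bottom>" and ?L = "rev_body e (shaved_profile h d) \<inter> {\<xi>}\<^sup>\<bottom>"
  let ?\<mu> = "coord_lborel (insert f B)"
  define q where "q = min 1 ((s / c)\<^sup>2)"
  have q: "0 \<le> q" "q \<le> 1" "q \<le> (s / c)\<^sup>2" by (auto simp: q_def)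
  define r where "r = sqrt (1 - q) ^ (?k - 2)"
  have r: "r \<ge> 0" using q by (simp add: r_def)
  have v: "?v > 0" by simp
  have k0: "?k > 0" using k by simp
  have closed: "closed ?M" "closed ?L"
    by (intro closed_Int closed_rev_body continuous_on_cap_profile continuous_on_shaved_profile
        closed_subspace[OF subspace_orthogonal_comp])+
  have sub: "rev_body e (shaved_profile h d) \<subseteq> rev_body e (cap_profile h)"
    by (intro rev_body_mono shaved_le_cap_profile)
  then have bounded: "bounded ?M" "bounded ?L"
    using bounded_rev_body_cap[OF e h] by (auto intro: bounded_subset)
  note M = emeasure_coord_lborel_eq_measure[OF basis(1) bounded(1) borel_closed[OF closed(1)]]
  note L = emeasure_coord_lborel_eq_measure[OF basis(1) bounded(2) borel_closed[OF closed(2)]]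
  \<comment> \<open>The gap vanishes for \<open>\<bar>t * c\<bar> \<le> 1\<close>; elsewhere the
    squared radius is lowered by \<open>(t * s)\<^sup>2\<close>, which is at least
    \<open>(s / c)\<^sup>2\<close> and hence at least \<open>q\<close>.\<close>
  have pt: "ball_radius_pow ?k (cap_profile h (t * c) - (t * s)\<^sup>2)
      - ball_radius_pow ?k (shaved_profile h d (t * c) - (t * s)\<^sup>2) \<le> r * profile_gap ?k h d (t * c)" for t
  proof (cases "\<bar>t * c\<bar> \<le> 1")
    case True
    then show ?thesis
      using h d r profile_gap_nonneg[of ?k h d "t * c"] by (simp add: cap_profile_eq_1 shaved_profile_eq_1)
  next
    case False
    then have "1 \<le> (t * c)\<^sup>2" by (metis abs_le_square_iff abs_one less_eq_real_def linorder_not_le one_power2)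
    then have "1 * (s / c)\<^sup>2 \<le> (t * c)\<^sup>2 * (s / c)\<^sup>2" by (intro mult_right_mono) auto
    also have "\<dots> = (t * s)\<^sup>2" using c by (simp add: power2_eq_square)
    finally have "q \<le> (t * s)\<^sup>2" using q by simp
    then show ?thesis
      unfolding r_def profile_gap_def using k q cap_profile_le_1[of h] shaved_le_cap_profile[of h d]
      by (intro ball_radius_pow_shift_diff) auto
  qed
  have "emeasure ?\<mu> ?M \<le> (\<integral>\<^sup>+t. ennreal (?v * ball_radius_pow ?k (shaved_profile h d (t * c) - (t * s)\<^sup>2))
      + ennreal (?v * r) * ennreal (profile_gap ?k h d (t * c)) \<partial>lborel)"
    unfolding emeasure_section[OF continuous_on_cap_profile k0]
  proof (rule nn_integral_mono)
    fix t
    have "?v * ball_radius_pow ?k (cap_profile h (t * c) - (t * s)\<^sup>2)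
        \<le> ?v * (ball_radius_pow ?k (shaved_profile h d (t * c) - (t * s)\<^sup>2) + r * profile_gap ?k h d (t * c))"
      using pt[of t] v by (intro mult_left_mono) auto
    then show "ennreal (?v * ball_radius_pow ?k (cap_profile h (t * c) - (t * s)\<^sup>2))
        \<le> ennreal (?v * ball_radius_pow ?k (shaved_profile h d (t * c) - (t * s)\<^sup>2))
          + ennreal (?v * r) * ennreal (profile_gap ?k h d (t * c))"
      using r profile_gap_nonneg[of ?k h d "t * c"]
      by (simp add: algebra_simps flip: ennreal_mult ennreal_plus)
  qed
  also have "\<dots> = emeasure ?\<mu> ?L + ennreal (?v * r) * (ennreal (1 / c) * ennreal E)"
  proof (subst nn_integral_add)
    show "(\<integral>\<^sup>+t. ennreal (?v * ball_radius_pow ?k (shaved_profile h d (t * c) - (t * s)\<^sup>2)) \<partial>lborel)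
        + (\<integral>\<^sup>+t. ennreal (?v * r) * ennreal (profile_gap ?k h d (t * c)) \<partial>lborel)
        = emeasure ?\<mu> ?L + ennreal (?v * r) * (ennreal (1 / c) * ennreal E)"
      unfolding emeasure_section[OF continuous_on_shaved_profile k0] E(1)[symmetric]
      by (subst nn_integral_cmult) (auto simp: nn_integral_scale_arg[OF _ c, symmetric])
  qed measurable
  also have "\<dots> = ennreal (measure ?\<mu> ?L + E * (?v * r / c))"
    using r c E by (simp add: L mult_ac flip: ennreal_mult ennreal_plus)
  finally have 1: "measure ?\<mu> ?M \<le> measure ?\<mu> ?L + E * (?v * r / c)"
    unfolding M using r c E by (subst (asm) ennreal_le_iff) auto
  \<comment> \<open>Only the part over the cylinder is counted, where the squared radius is
    \<open>1 - q * x\<^sup>2\<close> with \<open>x = t * c\<close>. For slope at least 1 the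
    positive exponent makes \<open>r = 0\<close> and the bound is trivial.\<close>
  have 2: "2 * (?v * r / c) \<le> measure ?\<mu> ?M"
  proof (cases "q < 1")
    case False
    then have "r = 0" using q k by (simp add: r_def)
    then show ?thesis by simp
  next
    case True
    then have q': "q = (s / c)\<^sup>2" by (simp add: q_def min_def split: if_splits)
    let ?F = "\<lambda>x. ennreal (ball_radius_pow ?k (1 - q * x\<^sup>2)) * indicator {-1..1} x"
    have "ennreal (2 * (?v * r / c)) = ennreal ?v * (ennreal (1 / c) * ennreal (2 * r))"
      using r c by (simp add: mult_ac flip: ennreal_mult)
    also have "\<dots> \<le> ennreal ?v * (ennreal (1 / c) * (\<integral>\<^sup>+x. ?F x \<partial>lborel))"
      unfolding r_def using integral_sqrt_pow_ge[OF k q(1) True] by (intro mult_left_mono) auto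
    also have "\<dots> = (\<integral>\<^sup>+t. ennreal ?v * ?F (t * c) \<partial>lborel)"
      using c by (subst nn_integral_cmult) (auto simp: nn_integral_scale_arg[of ?F])
    also have "\<dots> \<le> emeasure ?\<mu> ?M"
      unfolding emeasure_section[OF continuous_on_cap_profile k0]
    proof (rule nn_integral_mono)
      fix t
      have "q * (t * c)\<^sup>2 = (t * s)\<^sup>2" using c by (simp add: q' power2_eq_square)
      then show "ennreal ?v * ?F (t * c)
          \<le> ennreal (?v * ball_radius_pow ?k (cap_profile h (t * c) - (t * s)\<^sup>2))"
        using h by (cases "\<bar>t * c\<bar> \<le> 1") (auto simp: cap_profile_eq_1 indicator_def simp flip: ennreal_mult)
    qed
    finally show ?thesis by (simp add: M)
  qed
  have 3: "0 < measure ?\<mu> ?M"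
  proof -
    have "0 < emeasure ?\<mu> (cball 0 1)"
      by (simp add: emeasure_coord_lborel_cball[OF basis(1)])
    also have "\<dots> \<le> emeasure ?\<mu> ?M"
    proof (rule emeasure_coord_lborel_mono)
      have "span (insert f B) = {\<xi>}\<^sup>\<bottom>" using basis(1) by (simp add: orthonormal_basis_of_def)
      then show "cball 0 1 \<inter> span (insert f B) \<subseteq> ?M"
        using cball_le_rev_body_shaved[OF e h, of d] d sub by auto
    qed (use closed in auto)
    finally show ?thesis by (simp add: M)
  qed
  show ?thesis
    using r v c by (intro dilated_less[OF 1 2 3 _ m]) simp
qed

text \<open>The ring enters the shadow as the two ends of the gap, scaled by \<open>c\<close> and
  pushed outwards by \<open>b\<close>. Undoing the displacement on either side reassembles them into
  part of one integral of the even function \<open>profile_gap\<close>.\<close>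

lemma shadow_gap_integral:
  assumes E: "(\<integral>\<^sup>+x. ennreal (profile_gap k h d x) \<partial>lborel) = ennreal E"
  shows "(\<integral>\<^sup>+t. ennreal (if \<bar>t\<bar> \<le> c + b then 0 else profile_gap k h d ((\<bar>t\<bar> - b) / c)) \<partial>lborel)
    \<le> ennreal c * ennreal E"
proof -
  let ?F = "\<lambda>x. ennreal (profile_gap k h d x) * indicator {1<..} x"
  have shift: "(\<integral>\<^sup>+t. ?F ((a * t - b) / c) \<partial>lborel) = ennreal c * (\<integral>\<^sup>+x. ?F x \<partial>lborel)"
    if a: "a = 1 \<or> a = -1" for a
  proof -
    have "(\<integral>\<^sup>+t. ?F ((a * t - b) / c) \<partial>lborel)
        = ennreal \<bar>a * c\<bar> * (\<integral>\<^sup>+x. ?F ((a * (a * b + (a * c) * x) - b) / c) \<partial>lborel)"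
      using a c by (intro nn_integral_real_affine) auto
    moreover have "(a * (a * b + (a * c) * x) - b) / c = x" for x
      using a c by (auto simp: field_simps)
    moreover have "\<bar>a * c\<bar> = c" using a c by auto
    ultimately show ?thesis by simp
  qed
  have "(\<integral>\<^sup>+t. ennreal (if \<bar>t\<bar> \<le> c + b then 0 else profile_gap k h d ((\<bar>t\<bar> - b) / c)) \<partial>lborel)
      \<le> (\<integral>\<^sup>+t. ?F ((1 * t - b) / c) + ?F ((-1 * t - b) / c) \<partial>lborel)"
  proof (rule nn_integral_mono)
    fix t
    show "ennreal (if \<bar>t\<bar> \<le> c + b then 0 else profile_gap k h d ((\<bar>t\<bar> - b) / c))
        \<le> ?F ((1 * t - b) / c) + ?F ((-1 * t - b) / c)"
    proof (cases "\<bar>t\<bar> \<le> c + b")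
      case False
      then have "1 < (\<bar>t\<bar> - b) / c" using c by (simp add: less_divide_eq)
      then have "ennreal (profile_gap k h d ((\<bar>t\<bar> - b) / c)) \<le> ?F ((\<bar>t\<bar> - b) / c)"
        by simp
      moreover have "\<dots> \<le> ?F ((1 * t - b) / c) + ?F ((-1 * t - b) / c)"
        by (cases "t \<ge> 0") auto
      ultimately show ?thesis using False by (simp only: if_False order_trans)
    qed simp
  qed
  also have "\<dots> = ennreal c * ((\<integral>\<^sup>+x. ?F x \<partial>lborel) + (\<integral>\<^sup>+x. ?F x \<partial>lborel))"
    by (subst nn_integral_add) (auto simp: shift[of 1, simplified] shift[of "-1", simplified] distrib_left)
  \<comment> \<open>One copy is reflected to \<open>x < -1\<close>, so that the two fit disjointly
    under the full integral.\<close>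
  also have "(\<integral>\<^sup>+x. ?F x \<partial>lborel) + (\<integral>\<^sup>+x. ?F x \<partial>lborel)
      = (\<integral>\<^sup>+x. ?F x \<partial>lborel) + (\<integral>\<^sup>+x. ?F (0 + (-1) * x) \<partial>lborel)"
    by (subst (2) nn_integral_real_affine[where c = "-1" and t = 0]) auto
  also have "\<dots> = (\<integral>\<^sup>+x. ?F x + ?F (0 + (-1) * x) \<partial>lborel)"
    by (subst nn_integral_add) auto
  also have "\<dots> \<le> (\<integral>\<^sup>+x. ennreal (profile_gap k h d x) \<partial>lborel)"
    by (intro nn_integral_mono) (auto simp: indicator_def)
  finally show ?thesis unfolding E by (simp add: mult_left_mono)
qed

text \<open>With \<open>v = unit_ball_vol (card B)\<close> the weight of the direction is
  \<open>v * c\<close>: the ring costs at most \<open>v * c * E\<close>, and the shadow has measure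
  at least \<open>2 * v * c\<close>.\<close>

lemma shadow_less:
  assumes h: "h > 0" and d: "0 < d" "d < 1" and k: "card B \<ge> 3"
    and E: "(\<integral>\<^sup>+x. ennreal (profile_gap (card B) h d x) \<partial>lborel) = ennreal E" "E \<ge> 0"
    and m: "E < 2 * (1 - m)" "m < 1"
  shows "m * measure (coord_lborel (insert f B)) (orthogonal_projection ({\<xi>}\<^sup>\<bottom>) (rev_body e (cap_profile h)))
    < measure (coord_lborel (insert f B)) (orthogonal_projection ({\<xi>}\<^sup>\<bottom>) (rev_body e (shaved_profile h d)))"
proof -
  let ?k = "card B" and ?v = "unit_ball_vol (card B)"
  let ?M = "orthogonal_projection ({\<xi>}\<^sup>\<bottom>) (rev_body e (cap_profile h))"
  let ?L = "orthogonal_projection ({\<xi>}\<^sup>\<bottom>) (rev_body e (shaved_profile h d))"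
  let ?\<mu> = "coord_lborel (insert f B)" and ?\<nu> = "coord_lborel B"
  have v: "?v > 0" by simp
  have k0: "?k > 0" using k by simp
  have span: "span B = {e, g}\<^sup>\<bottom>" using B by (simp add: orthonormal_basis_of_def)
  have compact: "compact ?M" "compact ?L"
    using convex_body_rev_body[OF e h d] norm_\<xi>
    by (auto intro!: compact_orthogonal_projection_hyperplane simp: convex_body_def)
  then have borel: "?M \<in> sets borel" "?L \<in> sets borel"
    by (auto intro: borel_closed compact_imp_closed)
  note M = emeasure_coord_lborel_eq_measure[OF basis(1) compact_imp_bounded[OF compact(1)] borel(1)]
  note L = emeasure_coord_lborel_eq_measure[OF basis(1) compact_imp_bounded[OF compact(2)] borel(2)]
  have sl: "(\<lambda>w. t *\<^sub>R f + w) -` A \<in> sets borel" if "A \<in> sets borel" for A t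
    using measurable_sets[OF _ that, of "\<lambda>w. t *\<^sub>R f + w" borel] by simp
  have bl: "{w::'a. (norm w)\<^sup>2 \<le> u} \<in> sets borel" for u by measurable
  let ?sM = "\<lambda>t. emeasure ?\<nu> ((\<lambda>w. t *\<^sub>R f + w) -` ?M)"
  let ?sL = "\<lambda>t. emeasure ?\<nu> ((\<lambda>w. t *\<^sub>R f + w) -` ?L)"
  define j where "j = s / (2 * h * c)"
  let ?H = "\<lambda>t. if \<bar>t\<bar> \<le> c + s * j then 0 else profile_gap ?k h d ((\<bar>t\<bar> - s * j) / c)"
  \<comment> \<open>Up to \<open>c + s * j\<close> nothing is lost. Beyond, the slices are compared
    with balls whose squared radii are the two profiles at the displaced abscissa minus
    \<open>j\<^sup>2\<close>; this common shift cannot enlarge the difference of volumes.\<close>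
  have slice: "?sM t \<le> ?sL t + ennreal ?v * ennreal (?H t)" for t
  proof (cases "\<bar>t\<bar> \<le> c + s * j")
    case True
    have "?sM t \<le> ?sL t"
    proof (rule emeasure_coord_lborel_mono[OF sl[OF borel(1)] sl[OF borel(2)]], rule subsetI)
      fix w assume "w \<in> (\<lambda>w. t *\<^sub>R f + w) -` ?M \<inter> span B"
      then have w: "w \<in> {e, g}\<^sup>\<bottom>" and "t *\<^sub>R f + w \<in> ?M" by (auto simp: span)
      then obtain x y where "c * x + s * y = t" "y\<^sup>2 + (norm w)\<^sup>2 \<le> cap_profile h x"
        using mem_shadow[OF w] by blast
      then have "\<exists>x y. c * x + s * y = t \<and> y\<^sup>2 + (norm w)\<^sup>2 \<le> shaved_profile h d x"
        using shadow_slice_same[OF h d c s, of x y "(norm w)\<^sup>2"] True by (simp add: j_def)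
      then show "w \<in> (\<lambda>w. t *\<^sub>R f + w) -` ?L" using mem_shadow[OF w] by simp
    qed
    then show ?thesis by (rule order_trans) simp
  next
    case False
    let ?z = "(\<bar>t\<bar> - s * j) / c"
    have "?sM t \<le> emeasure ?\<nu> {w. (norm w)\<^sup>2 \<le> cap_profile h ?z - j\<^sup>2}"
    proof (rule emeasure_coord_lborel_mono[OF sl[OF borel(1)] bl], rule subsetI)
      fix w assume "w \<in> (\<lambda>w. t *\<^sub>R f + w) -` ?M \<inter> span B"
      then have w: "w \<in> {e, g}\<^sup>\<bottom>" and "t *\<^sub>R f + w \<in> ?M" by (auto simp: span)
      then obtain x y where xy: "c * x + s * y = t" "y\<^sup>2 + (norm w)\<^sup>2 \<le> cap_profile h x"
        using mem_shadow[OF w] by blast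
      then show "w \<in> {w. (norm w)\<^sup>2 \<le> cap_profile h ?z - j\<^sup>2}"
        using shadow_slice_upper[OF h c s _ xy(2)] False by (simp add: j_def)
    qed
    also have "\<dots> = ennreal (?v * ball_radius_pow ?k (cap_profile h ?z - j\<^sup>2))"
      by (rule emeasure_coord_lborel_sqball[OF B k0])
    also have "\<dots> \<le> ennreal (?v * ball_radius_pow ?k (shaved_profile h d ?z - j\<^sup>2))
        + ennreal ?v * ennreal (?H t)"
    proof -
      have "ball_radius_pow ?k (cap_profile h ?z - j\<^sup>2) - ball_radius_pow ?k (shaved_profile h d ?z - j\<^sup>2)
          \<le> profile_gap ?k h d ?z"
        using ball_radius_pow_shift_diff[of ?k "shaved_profile h d ?z" "cap_profile h ?z" 0 "j\<^sup>2"] k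
          shaved_le_cap_profile[of h d ?z] cap_profile_le_1[of h ?z]
        by (simp add: profile_gap_def)
      then have "?v * ball_radius_pow ?k (cap_profile h ?z - j\<^sup>2)
          \<le> ?v * (ball_radius_pow ?k (shaved_profile h d ?z - j\<^sup>2) + profile_gap ?k h d ?z)"
        using v by (intro mult_left_mono) auto
      then show ?thesis
        using False profile_gap_nonneg[of ?k h d ?z]
        by (simp add: distrib_left flip: ennreal_mult ennreal_plus)
    qed
    also have "ennreal (?v * ball_radius_pow ?k (shaved_profile h d ?z - j\<^sup>2)) \<le> ?sL t"
      unfolding emeasure_coord_lborel_sqball[OF B k0, symmetric]
    proof (rule emeasure_coord_lborel_mono[OF bl sl[OF borel(2)]], rule subsetI)
      fix w assume "w \<in> {w. (norm w)\<^sup>2 \<le> shaved_profile h d ?z - j\<^sup>2} \<inter> span B"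
      then have w: "w \<in> {e, g}\<^sup>\<bottom>" and le: "(norm w)\<^sup>2 \<le> shaved_profile h d ?z - j\<^sup>2" by (auto simp: span)
      then have "\<exists>x y. c * x + s * y = t \<and> y\<^sup>2 + (norm w)\<^sup>2 \<le> shaved_profile h d x"
        unfolding j_def by (intro shadow_slice_lower[OF c])
      then show "w \<in> (\<lambda>w. t *\<^sub>R f + w) -` ?L" using mem_shadow[OF w] by simp
    qed
    finally show ?thesis by (simp add: add_right_mono)
  qed
  have meas: "?sL \<in> borel_measurable borel"
    by (rule borel_measurable_coord_lborel_slice[OF finB borel(2)])
  have "emeasure ?\<mu> ?M \<le> (\<integral>\<^sup>+t. ?sL t + ennreal ?v * ennreal (?H t) \<partial>lborel)"
    unfolding emeasure_coord_lborel_insert[OF finB basis(2) borel(1)]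
    by (intro nn_integral_mono slice)
  also have "\<dots> = emeasure ?\<mu> ?L + ennreal ?v * (\<integral>\<^sup>+t. ennreal (?H t) \<partial>lborel)"
    unfolding emeasure_coord_lborel_insert[OF finB basis(2) borel(2)]
    using meas by (subst nn_integral_add) (auto simp: nn_integral_cmult)
  also have "\<dots> \<le> emeasure ?\<mu> ?L + ennreal ?v * (ennreal c * ennreal E)"
    by (intro add_left_mono mult_left_mono shadow_gap_integral[OF E(1)]) auto
  also have "\<dots> = ennreal (measure ?\<mu> ?L + E * (?v * c))"
    using c E by (simp add: L mult_ac flip: ennreal_mult ennreal_plus)
  finally have 1: "measure ?\<mu> ?M \<le> measure ?\<mu> ?L + E * (?v * c)"
    unfolding M using c E by (subst (asm) ennreal_le_iff) auto
  \<comment> \<open>For \<open>\<bar>t\<bar> \<le> c\<close> the line passes through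
    \<open>(t / c, 0)\<close>, over the cylinder, so the shadow slice contains a unit ball.\<close>
  have "ennreal (2 * (?v * c)) = (\<integral>\<^sup>+t. ennreal ?v * indicator {-c..c} t \<partial>lborel)"
    using c by (subst nn_integral_cmult_indicator) (auto simp: mult_ac simp flip: ennreal_mult)
  also have "\<dots> \<le> emeasure ?\<mu> ?M"
    unfolding emeasure_coord_lborel_insert[OF finB basis(2) borel(1)]
  proof (rule nn_integral_mono)
    fix t
    have "ennreal ?v \<le> ?sM t" if t: "\<bar>t\<bar> \<le> c"
    proof -
      have "ennreal ?v = emeasure ?\<nu> {w. (norm w)\<^sup>2 \<le> 1}"
        by (simp add: emeasure_coord_lborel_sqball[OF B k0])
      also have "\<dots> \<le> ?sM t"
      proof (rule emeasure_coord_lborel_mono[OF bl sl[OF borel(1)]], rule subsetI)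
        fix w assume "w \<in> {w. (norm w)\<^sup>2 \<le> 1} \<inter> span B"
        then have w: "w \<in> {e, g}\<^sup>\<bottom>" and le: "(norm w)\<^sup>2 \<le> 1" by (auto simp: span)
        have "\<bar>t / c\<bar> \<le> 1" using t c by simp
        then have "c * (t / c) + s * 0 = t \<and> 0\<^sup>2 + (norm w)\<^sup>2 \<le> cap_profile h (t / c)"
          using h c le by (simp add: cap_profile_eq_1)
        then show "w \<in> (\<lambda>w. t *\<^sub>R f + w) -` ?M"
          using mem_shadow[OF w] by blast
      qed
      finally show ?thesis .
    qed
    then show "ennreal ?v * indicator {-c..c} t \<le> ?sM t"
      by (auto simp: indicator_def abs_le_iff)
  qed
  finally have 2: "2 * (?v * c) \<le> measure ?\<mu> ?M" by (simp add: M)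
  show ?thesis
    using v c 2 mult_pos_pos[OF v c] by (intro dilated_less[OF 1 2 _ _ m]) linarith+
qed

end

section \<open>Comparison of volumes\<close>

text \<open>Orthogonally to the axis, section and shadow of either body are the unit ball, so in
  this direction the dilation alone decides.\<close>

lemma axis_hyperplane_measure:
  fixes e :: "'a::euclidean_space"
  assumes e: "norm e = 1" and B: "orthonormal_basis_of ({e}\<^sup>\<bottom>) B" "card B > 0"
    and A: "A 0 = 1" "\<And>x. A x \<le> 1" and K: "compact (rev_body e A)"
  shows "measure (coord_lborel B) (rev_body e A \<inter> {e}\<^sup>\<bottom>) = unit_ball_vol (card B)"
    "measure (coord_lborel B) (orthogonal_projection ({e}\<^sup>\<bottom>) (rev_body e A)) = unit_ball_vol (card B)"
proof -
  have span: "span B = {e}\<^sup>\<bottom>" using B by (simp add: orthonormal_basis_of_def)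
  have ee: "e \<bullet> e = 1" using e by (simp add: norm_eq_1)
  have *: "measure (coord_lborel B) Z = unit_ball_vol (card B)"
    if Z: "compact Z" "\<And>w. w \<bullet> e = 0 \<Longrightarrow> w \<in> Z \<longleftrightarrow> norm w \<le> 1" for Z
  proof -
    have "Z \<in> sets borel" using Z(1) by (intro borel_closed compact_imp_closed)
    then have "emeasure (coord_lborel B) Z = emeasure (coord_lborel B) (cball 0 1)"
      using Z(2) by (intro antisym emeasure_coord_lborel_mono) (auto simp: span orthogonal_comp_singleton)
    then show ?thesis
      by (simp add: measure_def emeasure_coord_lborel_cball[OF B(1)])
  qed
  have mem: "x *\<^sub>R e + w \<in> rev_body e A \<longleftrightarrow> (norm w)\<^sup>2 \<le> A x" if "w \<bullet> e = 0" for x w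
    using rev_body_axis[OF e that] .
  show "measure (coord_lborel B) (rev_body e A \<inter> {e}\<^sup>\<bottom>) = unit_ball_vol (card B)"
  proof (rule *)
    show "compact (rev_body e A \<inter> {e}\<^sup>\<bottom>)"
      using K by (intro compact_Int_closed closed_subspace subspace_orthogonal_comp)
    fix w :: 'a assume "w \<bullet> e = 0"
    then show "w \<in> rev_body e A \<inter> {e}\<^sup>\<bottom> \<longleftrightarrow> norm w \<le> 1"
      using mem[of w 0] by (simp add: A(1) orthogonal_comp_singleton abs_square_le_1)
  qed
  show "measure (coord_lborel B) (orthogonal_projection ({e}\<^sup>\<bottom>) (rev_body e A)) = unit_ball_vol (card B)"
  proof (rule *)
    show "compact (orthogonal_projection ({e}\<^sup>\<bottom>) (rev_body e A))"
      by (rule compact_orthogonal_projection_hyperplane[OF e K])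
    fix w :: 'a assume w: "w \<bullet> e = 0"
    show "w \<in> orthogonal_projection ({e}\<^sup>\<bottom>) (rev_body e A) \<longleftrightarrow> norm w \<le> 1"
    proof
      assume "w \<in> orthogonal_projection ({e}\<^sup>\<bottom>) (rev_body e A)"
      then obtain v where v: "v \<in> rev_body e A" "w = v - (v \<bullet> e) *\<^sub>R e"
        unfolding orthogonal_projection_hyperplane[OF e] by auto
      then have "(norm w)\<^sup>2 \<le> 1" using A(2)[of "v \<bullet> e"] by (simp add: rev_body_def)
      then show "norm w \<le> 1" by (simp add: abs_square_le_1)
    next
      assume "norm w \<le> 1"
      then have "w \<in> rev_body e A" using mem[OF w, of 0] by (simp add: A(1) abs_square_le_1)
      then show "w \<in> orthogonal_projection ({e}\<^sup>\<bottom>) (rev_body e A)"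
        unfolding orthogonal_projection_hyperplane[OF e] using w by (intro image_eqI[of _ _ w]) auto
    qed
  qed
qed

text \<open>With \<open>v = unit_ball_vol (Suc k)\<close>, the ring weighs at least
  \<open>v * (1 - d) * ((k + 1) / k) * E\<close> by \<open>profile_gap_Suc_ge\<close>. The dilation
  removes the fraction \<open>1 - m\<close> of a volume that is at most
  \<open>2 * v * (1 + h)\<close>, by the circumscribed cylinder.\<close>

lemma volume_greater:
  fixes e :: "'a::euclidean_space"
  assumes e: "norm e = 1" and h: "h > 0" and d: "0 < d" "d < 1"
    and k: "DIM('a) = k + 2" "k > 0"
    and E: "(\<integral>\<^sup>+x. ennreal (profile_gap k h d x) \<partial>lborel) = ennreal E" "E \<ge> 0"
    and m: "(1 - m) * (2 * (1 + h)) < (1 - d) * (real (Suc k) / real k) * E" "m < 1"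
  shows "measure lborel (rev_body e (shaved_profile h d)) < m * measure lborel (rev_body e (cap_profile h))"
proof -
  obtain B where B: "orthonormal_basis_of ({e}\<^sup>\<bottom>) B"
    using orthonormal_basis_of_exists[OF subspace_orthogonal_comp] by blast
  have ee: "e \<bullet> e = 1" using e by (simp add: norm_eq_1)
  have "card B = DIM('a) - 1"
    using e by (intro card_orthonormal_basis_of_hyperplane[OF B]) auto
  then have card: "card B = Suc k" using k by simp
  have U: "orthonormal_basis_of UNIV (insert e B)" "e \<notin> B"
    using orthonormal_basis_of_insert[OF B subspace_UNIV subset_UNIV e UNIV_I]
    by (auto simp: orthogonal_comp_singleton inner_diff_left ee)
  let ?\<mu> = "coord_lborel (insert e B)" and ?v = "unit_ball_vol (Suc k)"
  let ?M = "rev_body e (cap_profile h)" and ?L = "rev_body e (shaved_profile h d)"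
  have v: "?v > 0" by simp
  have lb: "measure lborel Z = measure ?\<mu> Z" for Z :: "'a set"
    using subspace_volume_UNIV[of Z] subspace_volume_eq[OF U(1), of Z] by simp
  have compact: "compact ?M" "compact ?L"
    using convex_body_rev_body[OF e h d] by (auto simp: convex_body_def)
  then have borel: "?M \<in> sets borel" "?L \<in> sets borel"
    by (auto intro: borel_closed compact_imp_closed)
  have M: "emeasure ?\<mu> ?M = ennreal (measure ?\<mu> ?M)"
    using U(1) compact borel by (intro emeasure_coord_lborel_eq_measure compact_imp_bounded)
  have L: "emeasure ?\<mu> ?L = ennreal (measure ?\<mu> ?L)"
    using U(1) compact borel by (intro emeasure_coord_lborel_eq_measure compact_imp_bounded)
  have eq: "emeasure ?\<mu> (rev_body e A)
      = (\<integral>\<^sup>+t. ennreal (?v * ball_radius_pow (Suc k) (A t)) \<partial>lborel)"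
    if "rev_body e A \<in> sets borel" for A
    using that emeasure_coord_lborel_round_slices[OF B _ U(2), of "rev_body e A" A]
    by (simp add: card rev_body_axis[OF e] orthogonal_comp_singleton)
  define a where "a = (1 - d) * (real (Suc k) / real k)"
  have a: "a \<ge> 0" using d by (simp add: a_def)
  have va: "?v * a \<ge> 0" "?v * (a * E) \<ge> 0"
    using a E(2) v by (auto intro!: mult_nonneg_nonneg simp del: of_nat_Suc)
  have "ennreal (measure ?\<mu> ?L + ?v * (a * E)) = emeasure ?\<mu> ?L + ennreal (?v * a) * ennreal E"
    unfolding L ennreal_mult[OF va(1) E(2), symmetric] mult.assoc
    by (rule ennreal_plus[OF measure_nonneg va(2)])
  also have "\<dots> = (\<integral>\<^sup>+t. ennreal (?v * ball_radius_pow (Suc k) (shaved_profile h d t))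
      + ennreal (?v * a) * ennreal (profile_gap k h d t) \<partial>lborel)"
  proof (subst nn_integral_add)
    show "emeasure ?\<mu> ?L + ennreal (?v * a) * ennreal E
        = (\<integral>\<^sup>+t. ennreal (?v * ball_radius_pow (Suc k) (shaved_profile h d t)) \<partial>lborel)
          + (\<integral>\<^sup>+t. ennreal (?v * a) * ennreal (profile_gap k h d t) \<partial>lborel)"
      unfolding eq[OF borel(2)] E(1)[symmetric] by (subst nn_integral_cmult) auto
  qed measurable
  also have "\<dots> \<le> emeasure ?\<mu> ?M"
    unfolding eq[OF borel(1)]
  proof (rule nn_integral_mono)
    fix t
    have "?v * (ball_radius_pow (Suc k) (shaved_profile h d t) + a * profile_gap k h d t)
        \<le> ?v * ball_radius_pow (Suc k) (cap_profile h t)"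
      using profile_gap_Suc_ge[OF h d k(2), of t, folded a_def] v
      by (intro mult_left_mono) (auto simp: profile_gap_def)
    then have "ennreal (?v * ball_radius_pow (Suc k) (shaved_profile h d t) + (?v * a) * profile_gap k h d t)
        \<le> ennreal (?v * ball_radius_pow (Suc k) (cap_profile h t))"
      by (intro ennreal_leI) (simp only: distrib_left mult.assoc)
    then show "ennreal (?v * ball_radius_pow (Suc k) (shaved_profile h d t))
        + ennreal (?v * a) * ennreal (profile_gap k h d t)
        \<le> ennreal (?v * ball_radius_pow (Suc k) (cap_profile h t))"
      unfolding ennreal_mult[OF va(1) profile_gap_nonneg, symmetric]
      using v va(1) profile_gap_nonneg[of k h d t]
      by (subst ennreal_plus[symmetric]) (auto intro!: mult_nonneg_nonneg simp del: of_nat_Suc)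
  qed
  finally have 1: "measure ?\<mu> ?L + ?v * (a * E) \<le> measure ?\<mu> ?M"
    unfolding M by (subst (asm) ennreal_le_iff) auto
  have "emeasure ?\<mu> ?M \<le> (\<integral>\<^sup>+t. ennreal ?v * indicator {-(1 + h)..1 + h} t \<partial>lborel)"
    unfolding eq[OF borel(1)]
  proof (rule nn_integral_mono)
    fix t
    show "ennreal (?v * ball_radius_pow (Suc k) (cap_profile h t)) \<le> ennreal ?v * indicator {-(1 + h)..1 + h} t"
    proof (cases "\<bar>t\<bar> \<le> 1 + h")
      case True
      then have "t \<in> {-(1 + h)..1 + h}" by auto
      moreover have "?v * ball_radius_pow (Suc k) (cap_profile h t) \<le> ?v * ball_radius_pow (Suc k) 1"
        using v by (intro mult_left_mono ball_radius_pow_mono cap_profile_le_1) auto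
      ultimately show ?thesis by (auto intro: ennreal_leI)
    next
      case False
      then show ?thesis using cap_profile_nonpos[OF h, of t] by (simp add: ball_radius_pow_nonpos)
    qed
  qed
  also have "\<dots> = ennreal ?v * emeasure lborel {-(1 + h)..1 + h}"
    by (rule nn_integral_cmult_indicator) simp
  also have "emeasure lborel {-(1 + h)..1 + h} = ennreal (2 * (1 + h))" using h by simp
  also have "ennreal ?v * ennreal (2 * (1 + h)) = ennreal (?v * (2 * (1 + h)))"
    using v h by (intro ennreal_mult[symmetric] less_imp_le) auto
  finally have 2: "measure ?\<mu> ?M \<le> ?v * (2 * (1 + h))"
    unfolding M using h by (subst (asm) ennreal_le_iff) auto
  have "(1 - m) * measure ?\<mu> ?M \<le> (1 - m) * (?v * (2 * (1 + h)))"
    using 2 m(2) by (intro mult_left_mono) auto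
  also have "\<dots> = ?v * ((1 - m) * (2 * (1 + h)))" by simp
  also have "\<dots> < ?v * (a * E)" using m(1) v by (intro mult_strict_left_mono) (simp only: a_def)
  finally have "(1 - m) * measure ?\<mu> ?M < ?v * (a * E)" .
  moreover have "(1 - m) * measure ?\<mu> ?M = measure ?\<mu> ?M - m * measure ?\<mu> ?M"
    by (simp add: left_diff_distrib)
  ultimately show ?thesis unfolding lb using 1 by linarith
qed

text \<open>The locale covers every direction except the axis itself, where
  \<open>axis_hyperplane_measure\<close> takes over. The factor \<open>m\<close> stands for the
  effect of the dilation on volumes in a hyperplane.\<close>

lemma hyperplane_volume_less:
  fixes e \<xi> :: "'a::euclidean_space"
  assumes e: "norm e = 1" and h: "h > 0" and d: "0 < d" "d < 1"
    and k: "DIM('a) = k + 2" "k \<ge> 3" and dir: "norm \<xi> = 1"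
    and E: "(\<integral>\<^sup>+x. ennreal (profile_gap k h d x) \<partial>lborel) = ennreal E" "E \<ge> 0"
    and m: "E < 2 * (1 - m)" "m < 1"
  shows "m * subspace_volume ({\<xi>}\<^sup>\<bottom>) (rev_body e (cap_profile h) \<inter> {\<xi>}\<^sup>\<bottom>)
      < subspace_volume ({\<xi>}\<^sup>\<bottom>) (rev_body e (shaved_profile h d) \<inter> {\<xi>}\<^sup>\<bottom>)" (is ?S)
    and "m * subspace_volume ({\<xi>}\<^sup>\<bottom>) (orthogonal_projection ({\<xi>}\<^sup>\<bottom>) (rev_body e (cap_profile h)))
      < subspace_volume ({\<xi>}\<^sup>\<bottom>) (orthogonal_projection ({\<xi>}\<^sup>\<bottom>) (rev_body e (shaved_profile h d)))" (is ?P)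
proof -
  have "?S \<and> ?P"
  proof (cases "\<xi> = e \<or> \<xi> = - e")
    case True
    then have perp: "{\<xi>}\<^sup>\<bottom> = {e}\<^sup>\<bottom>" by (auto simp: orthogonal_comp_singleton)
    obtain B where B: "orthonormal_basis_of ({e}\<^sup>\<bottom>) B"
      using orthonormal_basis_of_exists[OF subspace_orthogonal_comp] by blast
    have "card B = DIM('a) - 1"
      using e by (intro card_orthonormal_basis_of_hyperplane[OF B]) auto
    then have card: "card B > 0" using k by simp
    have compact: "compact (rev_body e (cap_profile h))" "compact (rev_body e (shaved_profile h d))"
      using convex_body_rev_body[OF e h d] by (auto simp: convex_body_def)
    have A: "cap_profile h 0 = 1" "shaved_profile h d 0 = 1"
      using h d by (auto simp: cap_profile_eq_1 shaved_profile_eq_1)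
    have le: "shaved_profile h d x \<le> 1" for x
      using shaved_le_cap_profile cap_profile_le_1 by (rule order_trans)
    have "m * unit_ball_vol (card B) < 1 * unit_ball_vol (card B)"
      using m by (intro mult_strict_right_mono) auto
    then show ?thesis
      unfolding perp subspace_volume_eq[OF B]
      by (simp add: axis_hyperplane_measure[OF e B card, where A = "cap_profile h"]
          axis_hyperplane_measure[OF e B card, where A = "shaved_profile h d"] A le cap_profile_le_1 compact)
  next
    case False
    then obtain g c s B where "tilted_hyperplane e g \<xi> c s B"
      using tilted_hyperplane_exists[OF e dir] by metis
    then interpret tilted_hyperplane e g \<xi> c s B .
    have "card (insert f B) = DIM('a) - 1"
      using dir by (intro card_orthonormal_basis_of_hyperplane[OF basis(1)]) auto
    then have card: "card B = k" using k basis(2) finB by simp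
    show ?thesis
      unfolding subspace_volume_eq[OF basis(1)]
      using section_less[OF h d _ _ E(2) m] shadow_less[OF h d _ _ E(2) m] E(1) k(2)
      by (simp add: card)
  qed
  then show ?S ?P by auto
qed

section \<open>Dilations and the final assembly\<close>

lemma subspace_volume_scale:
  fixes A :: "'a::euclidean_space set"
  assumes "subspace S" "c > 0" "A \<in> sets borel"
  shows "subspace_volume S ((*\<^sub>R) c ` A) = c ^ dim S * subspace_volume S A"
proof -
  obtain B where B: "orthonormal_basis_of S B"
    using orthonormal_basis_of_exists[OF assms(1)] by blast
  have fin: "finite B" using B by (rule orthonormal_basis_of_finite)
  have ind: "independent B"
    using B by (intro pairwise_orthogonal_independent) (auto simp: orthonormal_basis_of_def)
  have card: "card B = dim S"
    using dim_span_eq_card_independent[OF ind] B unfolding orthonormal_basis_of_def by metis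
  show ?thesis
    unfolding subspace_volume_eq[OF B] card[symmetric] by (rule measure_scale_subspace[OF fin assms(2,3)])
qed

lemma section_scale:
  fixes A :: "'a::euclidean_space set"
  assumes "subspace S" "c \<noteq> 0"
  shows "(*\<^sub>R) c ` A \<inter> S = (*\<^sub>R) c ` (A \<inter> S)"
proof
  show "(*\<^sub>R) c ` A \<inter> S \<subseteq> (*\<^sub>R) c ` (A \<inter> S)"
  proof
    fix v assume "v \<in> (*\<^sub>R) c ` A \<inter> S"
    then obtain a where a: "a \<in> A" "v = c *\<^sub>R a" "c *\<^sub>R a \<in> S" by auto
    then have "a \<in> S" using subspace_scale[OF assms(1) a(3), of "inverse c"] assms(2) by simp
    then show "v \<in> (*\<^sub>R) c ` (A \<inter> S)" using a by auto
  qed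
  show "(*\<^sub>R) c ` (A \<inter> S) \<subseteq> (*\<^sub>R) c ` A \<inter> S"
    using assms(1) by (auto simp: subspace_scale)
qed

lemma orthogonal_projection_hyperplane_scale:
  fixes A :: "'a::euclidean_space set"
  assumes "norm \<xi> = 1"
  shows "orthogonal_projection ({\<xi>}\<^sup>\<bottom>) ((*\<^sub>R) c ` A) = (*\<^sub>R) c ` orthogonal_projection ({\<xi>}\<^sup>\<bottom>) A"
  unfolding orthogonal_projection_hyperplane[OF assms] image_image
  by (simp add: scaleR_diff_right)

theorem theorem1p1:
  assumes "CARD('n::finite) \<ge> 5"
  shows "\<exists>K L :: (real ^ 'n) set.
     convex_body K \<and> origin_symmetric K \<and> body_of_revolution K \<and>
     convex_body L \<and> origin_symmetric L \<and> body_of_revolution L \<and>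
     (\<forall>\<xi>\<in>sphere 0 1.
        subspace_volume ({\<xi>}\<^sup>\<bottom>) (K \<inter> {\<xi>}\<^sup>\<bottom>) < subspace_volume ({\<xi>}\<^sup>\<bottom>) (L \<inter> {\<xi>}\<^sup>\<bottom>) \<and>
        subspace_volume ({\<xi>}\<^sup>\<bottom>) (orthogonal_projection ({\<xi>}\<^sup>\<bottom>) K)
          < subspace_volume ({\<xi>}\<^sup>\<bottom>) (orthogonal_projection ({\<xi>}\<^sup>\<bottom>) L)) \<and>
     measure lebesgue K > measure lebesgue L"
proof -
  \<comment> \<open>\<open>k\<close> is the dimension of the round slices of a hyperplane section,
    so dimension at least 5 becomes \<open>k \<ge> 3\<close>.\<close>
  define k where "k = CARD('n) - 2"
  have k: "DIM(real ^ 'n) = k + 2" "k \<ge> 3" using assms by (auto simp: k_def)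
  have k0: "k > 0" "k \<ge> 1" using k by auto
  \<comment> \<open>The same \<open>h\<close> is used for the height of the caps and for the
    parameter \<open>d\<close> of the cone; \<open>h \<le> 1 / 2\<close> ensures
    \<open>E \<le> 1\<close>.\<close>
  obtain h :: real where h: "0 < h" "h \<le> 1 / 2"
    "(1 + h) * (1 + h) * (real k * (real k + 2)) < (1 - h) * (real k + 1)\<^sup>2"
    using small_parameter[OF k0(2)] by blast
  have h1: "h < 1" using h by simp
  obtain E where E: "(\<integral>\<^sup>+x. ennreal (profile_gap k h h x) \<partial>lborel) = ennreal E" "0 < E" "E \<le> 2 * h"
    using nn_integral_profile_gap[OF h(1) h(1) h1 k0(1)] by blast
  have E0: "E \<ge> 0" "E \<le> 1" using E h by auto
  \<comment> \<open>\<open>k + 1\<close> and \<open>k + 2\<close> are the dimensions of a hyperplane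
    and of the space, so the first bound on \<open>E\<close> governs sections and shadows, the
    second the volume.\<close>
  obtain c where c: "0 < c" "c < 1" "E < 2 * (1 - c ^ (k + 1))"
    "(1 - c ^ (k + 2)) * (2 * (1 + h)) < (1 - h) * (real (Suc k) / real k) * E"
    using choose_dilation[OF k0(1) E(2) E0(2) h(1) h(1) h(3) h1] by blast
  have c1: "c ^ (k + 1) < 1" "c ^ (k + 2) < 1" using c by (auto simp: power_less_one_iff simp del: power_Suc)
  obtain e :: "real ^ 'n" where e: "norm e = 1" using vector_choose_size[of 1] by auto
  let ?M = "rev_body e (cap_profile h)" and ?L = "rev_body e (shaved_profile h h)"
  have e0: "e \<noteq> 0" using e by auto
  note bodies = convex_body_rev_body[OF e h(1) h(1) h1]
  have compact: "compact ?M" "compact ?L" using bodies by (auto simp: convex_body_def)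
  have closed: "closed ?M" "closed ?L" using compact by (auto intro: compact_imp_closed)
  have "subspace_volume ({\<xi>}\<^sup>\<bottom>) ((*\<^sub>R) c ` ?M \<inter> {\<xi>}\<^sup>\<bottom>) < subspace_volume ({\<xi>}\<^sup>\<bottom>) (?L \<inter> {\<xi>}\<^sup>\<bottom>)"
    "subspace_volume ({\<xi>}\<^sup>\<bottom>) (orthogonal_projection ({\<xi>}\<^sup>\<bottom>) ((*\<^sub>R) c ` ?M))
      < subspace_volume ({\<xi>}\<^sup>\<bottom>) (orthogonal_projection ({\<xi>}\<^sup>\<bottom>) ?L)"
    if \<xi>: "norm \<xi> = 1" for \<xi> :: "real ^ 'n"
  proof -
    have sub: "subspace ({\<xi>}\<^sup>\<bottom>)" by (rule subspace_orthogonal_comp)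
    have "{\<xi>}\<^sup>\<bottom> = {x. \<xi> \<bullet> x = 0}" by (auto simp: orthogonal_comp_singleton inner_commute)
    moreover have "\<xi> \<noteq> 0" using \<xi> by auto
    ultimately have dim: "dim ({\<xi>}\<^sup>\<bottom>) = k + 1" using k(1) by (simp add: dim_hyperplane)
    have b: "?M \<inter> {\<xi>}\<^sup>\<bottom> \<in> sets borel" "orthogonal_projection ({\<xi>}\<^sup>\<bottom>) ?M \<in> sets borel"
      using closed_subspace[OF sub] closed compact_orthogonal_projection_hyperplane[OF \<xi> compact(1)]
      by (auto intro!: borel_closed compact_imp_closed)
    note less = hyperplane_volume_less[OF e h(1) h(1) h1 k \<xi> E(1) E0(1) c(3) c1(1)]
    show "subspace_volume ({\<xi>}\<^sup>\<bottom>) ((*\<^sub>R) c ` ?M \<inter> {\<xi>}\<^sup>\<bottom>) < subspace_volume ({\<xi>}\<^sup>\<bottom>) (?L \<inter> {\<xi>}\<^sup>\<bottom>)"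
      using less(1) c(1) section_scale[OF sub, of c ?M] subspace_volume_scale[OF sub c(1) b(1)]
      by (simp add: dim)
    show "subspace_volume ({\<xi>}\<^sup>\<bottom>) (orthogonal_projection ({\<xi>}\<^sup>\<bottom>) ((*\<^sub>R) c ` ?M))
        < subspace_volume ({\<xi>}\<^sup>\<bottom>) (orthogonal_projection ({\<xi>}\<^sup>\<bottom>) ?L)"
      using less(2) orthogonal_projection_hyperplane_scale[OF \<xi>, of c ?M]
        subspace_volume_scale[OF sub c(1) b(2)]
      by (simp add: dim)
  qed
  moreover have "measure lebesgue ((*\<^sub>R) c ` ?M) > measure lebesgue ?L"
  proof -
    have "measure lborel ?L < c ^ (k + 2) * measure lborel ?M"
      by (rule volume_greater[OF e h(1) h(1) h1 k(1) k0(1) E(1) E0(1) c(4) c1(2)])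
    also have "\<dots> = measure lborel ((*\<^sub>R) c ` ?M)"
      using subspace_volume_scale[OF subspace_UNIV c(1) borel_closed[OF closed(1)]] k(1)
      unfolding subspace_volume_UNIV by simp
    also have "\<dots> = measure lebesgue ((*\<^sub>R) c ` ?M)"
      using closed_scaling[OF closed(1), of c] by (simp add: measure_completion borel_closed)
    finally show ?thesis using closed(2) by (simp add: measure_completion borel_closed)
  qed
  moreover have "origin_symmetric ?M" "origin_symmetric ?L"
    by (auto intro: origin_symmetric_rev_body)
  ultimately show ?thesis
    using bodies c(1) body_of_revolution_rev_body[OF e0]
    by (intro exI[of _ "(*\<^sub>R) c ` ?M"] exI[of _ ?L])
       (auto intro: convex_body_scale origin_symmetric_scale body_of_revolution_scale)
qed

end
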